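(* Let $G$ be a totally disconnected, locally compact group, let $\alpha\in\mathrm{Aut}(G)$ be contractive, and let $\Omega:=\langle\alpha\rangle\leq \mathrm{Aut}(G)$ or $\Omega:=\langle \mathrm{Int}(G)\cup\{\alpha\}\rangle\leq\mathrm{Aut}(G)$. Then $G$ admits an $\Omega$-composition series, and the following hold: (a) (Schreier Refinement Theorem) Any two $\Omega$-series of $G$ have $\Omega$-isomorphic refinements. (b) (Jordan–Hölder Theorem) If $\mathbf{S}$ is an $\Omega$-composition series and $\mathbf{T}$ is any $\Omega$-series of $G$, then $\mathbf{T}$ has a refinement which is an $\Omega$-composition series and is $\Omega$-isomorphic with $\mathbf{S}$. In particular, any two $\Omega$-composition series of $G$ are $\Omega$-isomorphic.
   Context: Topological groups are Hausdorff. $\mathrm{Aut}(G)$ is the group of bicontinuous automorphisms of the topological group $G$, $\mathrm{Int}(G)$ is its subgroup of inner automorphisms, and $\alpha\in\mathrm{Aut}(G)$ is contractive if $\alpha^n(x)\to1$ as $n\to\infty$ for each $x\in G$. For a set $\Omega$, a topological $\Omega$-group is a Hausdorff topological group $G$ with a map $\Omega\times G\to G$, $(\omega,g)\mapsto\omega.g$ such that $g\mapsto\omega.g$ is a continuous endomorphism for each $\omega\in\Omega$; here $\Omega\le\mathrm{Aut}(G)$ acts by evaluation. An $\Omega$-subgroup is a closed subgroup $H$ with $\Omega.H\subseteq H$. (So for $\Omega=\langle\alpha\rangle$ the $\Omega$-subgroups are the closed subgroups $H$ with $\alpha(H)=H$; for $\Omega=\langle\mathrm{Int}(G)\cup\{\alpha\}\rangle$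 they are those which are moreover normal in $G$.) $\Omega$-subgroups and quotients by normal $\Omega$-subgroups are topological $\Omega$-groups in the natural way; an $\Omega$-isomorphism is an isomorphism of topological groups commuting with the action of each $\omega\in\Omega$. An $\Omega$-series of $G$ is a series $\mathbf{1}=G_0\triangleleft G_1\triangleleft\cdots\triangleleft G_n=G$ (each $G_{j-1}$ normal in $G_j$) with all $G_j$ being $\Omega$-subgroups; its factors are the topological $\Omega$-groups $G_j/G_{j-1}$, $j=1,\ldots,n$ (one for each index $j$). A refinement of a series is a series among whose terms are all terms of the given one; it is proper if it contains an additional subgroup. An $\Omega$-composition series is an $\Omega$-series without repetitions which admits no proper refinement (to an $\Omega$-series). Two $\Omega$-series are $\Omega$-isomorphic if there is a bijection from the set of factors of one onto the set of factors of the other such that corresponding factors are $\Omega$-isomorphic. *)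

theory Defs
  imports
    "HOL-Analysis.Abstract_Topological_Spaces"
    "HOL-Algebra.Bij"
    "HOL-Algebra.Generated_Groups"
begin

section \<open>Topological preliminaries\<close>

definition totally_disconnected_space :: "'a topology \<Rightarrow> bool" where
  "totally_disconnected_space X \<longleftrightarrow> (\<forall>C. connectedin X C \<longrightarrow> (\<exists>a. C \<subseteq> {a}))"

definition quotient_topology :: "'a topology \<Rightarrow> ('a \<Rightarrow> 'b) \<Rightarrow> 'b topology" where
  "quotient_topology X q =
    topology (\<lambda>U. U \<subseteq> q ` topspace X \<and> openin X {x \<in> topspace X. q x \<in> U})"

lemma openin_quotient_topology:
  "openin (quotient_topology X q) U \<longleftrightarrow>
    U \<subseteq> q ` topspace X \<and> openin X {x \<in> topspace X. q x \<in> U}"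
proof -
  have "istopology (\<lambda>U. U \<subseteq> q ` topspace X \<and> openin X {x \<in> topspace X. q x \<in> U})"
    unfolding istopology_def
  proof (intro conjI allI impI)
    fix S T
    assume "S \<subseteq> q ` topspace X \<and> openin X {x \<in> topspace X. q x \<in> S}"
      and "T \<subseteq> q ` topspace X \<and> openin X {x \<in> topspace X. q x \<in> T}"
    moreover have "{x \<in> topspace X. q x \<in> S \<inter> T} =
        {x \<in> topspace X. q x \<in> S} \<inter> {x \<in> topspace X. q x \<in> T}" by blast
    ultimately show "S \<inter> T \<subseteq> q ` topspace X"
      and "openin X {x \<in> topspace X. q x \<in> S \<inter> T}" by auto
  next
    fix K
    assume K: "\<forall>S\<in>K. S \<subseteq> q ` topspace X \<and> openin X {x \<in> topspace X. q x \<in> S}"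
    then show "\<Union>K \<subseteq> q ` topspace X" by blast
    have "{x \<in> topspace X. q x \<in> \<Union>K} = (\<Union>S\<in>K. {x \<in> topspace X. q x \<in> S})" by blast
    with K show "openin X {x \<in> topspace X. q x \<in> \<Union>K}" by auto
  qed
  then show ?thesis
    by (simp add: quotient_topology_def topology_inverse')
qed

lemma topspace_quotient_topology [simp]:
  "topspace (quotient_topology X q) = q ` topspace X"
proof
  show "topspace (quotient_topology X q) \<subseteq> q ` topspace X"
    using openin_topspace[of "quotient_topology X q"]
    by (simp only: openin_quotient_topology)
  have "{x \<in> topspace X. q x \<in> q ` topspace X} = topspace X" by blast
  then have "openin (quotient_topology X q) (q ` topspace X)"
    by (simp add: openin_quotient_topology)
  then show "q ` topspace X \<subseteq> topspace (quotient_topology X q)"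
    by (rule openin_subset)
qed

lemma quotient_map_quotient_topology: "quotient_map X (quotient_topology X q) q"
  by (auto simp: quotient_map_def openin_quotient_topology)


section \<open>Topological groups and their automorphisms\<close>

record 'a top_group = "'a monoid" +
  topol :: "'a topology"

locale topological_group = group G for G :: "('a, 'b) top_group_scheme" (structure) +
  assumes topspace_topol: "topspace (topol G) = carrier G"
    and Hausdorff_topol: "Hausdorff_space (topol G)"
    and continuous_mult:
      "continuous_map (prod_topology (topol G) (topol G)) (topol G) (\<lambda>(x, y). x \<otimes> y)"
    and continuous_inv: "continuous_map (topol G) (topol G) (\<lambda>x. inv x)"

text \<open>As for \<^const>\<open>auto\<close>, automorphisms are extensional functions
  (\<^const>\<open>undefined\<close> off the carrier).\<close>

definition top_Aut :: "('a, 'b) top_group_scheme \<Rightarrow> ('a \<Rightarrow> 'a) monoid" where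
  "top_Aut G = (AutoGroup G)
    \<lparr>carrier := {f \<in> auto G. homeomorphic_map (topol G) (topol G) f}\<rparr>"

definition inner_automorphisms :: "('a, 'b) monoid_scheme \<Rightarrow> ('a \<Rightarrow> 'a) set" where
  "inner_automorphisms G =
    {(\<lambda>x\<in>carrier G. g \<otimes>\<^bsub>G\<^esub> x \<otimes>\<^bsub>G\<^esub> inv\<^bsub>G\<^esub> g) | g. g \<in> carrier G}"

definition contractive :: "('a, 'b) top_group_scheme \<Rightarrow> ('a \<Rightarrow> 'a) \<Rightarrow> bool" where
  "contractive G \<alpha> \<longleftrightarrow>
    (\<forall>x\<in>carrier G. limitin (topol G) (\<lambda>n. (\<alpha> ^^ n) x) \<one>\<^bsub>G\<^esub> sequentially)"


section \<open>Topological groups with operators\<close>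

record ('a, 'w) op_group = "'a top_group" +
  act :: "'w \<Rightarrow> 'a \<Rightarrow> 'a"

locale topological_op_group = topological_group G
  for \<Omega> :: "'w set" and G :: "('a, 'w, 'b) op_group_scheme" (structure) +
  assumes act_hom: "\<omega> \<in> \<Omega> \<Longrightarrow> act G \<omega> \<in> hom G G"
    and continuous_act: "\<omega> \<in> \<Omega> \<Longrightarrow> continuous_map (topol G) (topol G) (act G \<omega>)"

definition evaluation_op_group :: "('a, 'b) top_group_scheme \<Rightarrow> ('a, 'a \<Rightarrow> 'a) op_group" where
  "evaluation_op_group G =
    \<lparr>carrier = carrier G, mult = mult G, one = one G, topol = topol G, act = (\<lambda>\<omega> x. \<omega> x)\<rparr>"

definition op_subgroup :: "'w set \<Rightarrow> 'a set \<Rightarrow> ('a, 'w, 'b) op_group_scheme \<Rightarrow> bool" where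
  "op_subgroup \<Omega> H G \<longleftrightarrow>
    subgroup H G \<and> closedin (topol G) H \<and> (\<forall>\<omega>\<in>\<Omega>. \<forall>x\<in>H. act G \<omega> x \<in> H)"

definition induced_op_group :: "('a, 'w) op_group \<Rightarrow> 'a set \<Rightarrow> ('a, 'w) op_group" where
  "induced_op_group G H = G\<lparr>carrier := H, topol := subtopology (topol G) H\<rparr>"

text \<open>On the coset \<open>C = N #> x\<close> the union below is the single coset \<open>N #> act G \<omega> x\<close>,
  provided that \<open>act G \<omega>\<close> is an endomorphism mapping \<open>N\<close> into \<open>N\<close>;
  see \<open>act_quotient_op_group\<close>.\<close>

definition quotient_op_group :: "('a, 'w) op_group \<Rightarrow> 'a set \<Rightarrow> ('a set, 'w) op_group" where
  "quotient_op_group G N =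
    \<lparr>carrier = carrier (G Mod N), mult = mult (G Mod N), one = one (G Mod N),
     topol = quotient_topology (topol G) (\<lambda>x. N #>\<^bsub>G\<^esub> x),
     act = (\<lambda>\<omega> C. \<Union>x\<in>C. N #>\<^bsub>G\<^esub> act G \<omega> x)\<rparr>"

definition op_isomorphic ::
    "'w set \<Rightarrow> ('a, 'w) op_group \<Rightarrow> ('b, 'w) op_group \<Rightarrow> bool" where
  "op_isomorphic \<Omega> G H \<longleftrightarrow>
    (\<exists>f \<in> iso G H. homeomorphic_map (topol G) (topol H) f \<and>
      (\<forall>\<omega>\<in>\<Omega>. \<forall>x\<in>carrier G. f (act G \<omega> x) = act H \<omega> (f x)))"


section \<open>Series\<close>

text \<open>A series \<open>G\<^sub>0, \<dots>, G\<^sub>n\<close> is a list of length \<open>n + 1\<close>; the case \<open>n = 0\<close> is possible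
  exactly for the trivial group.\<close>

definition op_series :: "'w set \<Rightarrow> ('a, 'w) op_group \<Rightarrow> 'a set list \<Rightarrow> bool" where
  "op_series \<Omega> G S \<longleftrightarrow>
    S \<noteq> [] \<and> hd S = {\<one>\<^bsub>G\<^esub>} \<and> last S = carrier G \<and>
    (\<forall>H\<in>set S. op_subgroup \<Omega> H G) \<and>
    (\<forall>j. Suc j < length S \<longrightarrow> S ! j \<lhd> G\<lparr>carrier := S ! Suc j\<rparr>)"

definition series_factor :: "('a, 'w) op_group \<Rightarrow> 'a set list \<Rightarrow> nat \<Rightarrow> ('a set, 'w) op_group" where
  "series_factor G S j = quotient_op_group (induced_op_group G (S ! Suc j)) (S ! j)"

text \<open>Multiplicities of terms are disregarded: a series with repeated terms may have a
  refinement without repetitions.\<close>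

definition refinement :: "'w set \<Rightarrow> ('a, 'w) op_group \<Rightarrow> 'a set list \<Rightarrow> 'a set list \<Rightarrow> bool" where
  "refinement \<Omega> G S R \<longleftrightarrow> op_series \<Omega> G R \<and> set S \<subseteq> set R"

definition proper_refinement ::
    "'w set \<Rightarrow> ('a, 'w) op_group \<Rightarrow> 'a set list \<Rightarrow> 'a set list \<Rightarrow> bool" where
  "proper_refinement \<Omega> G S R \<longleftrightarrow> refinement \<Omega> G S R \<and> (\<exists>H\<in>set R. H \<notin> set S)"

definition composition_series :: "'w set \<Rightarrow> ('a, 'w) op_group \<Rightarrow> 'a set list \<Rightarrow> bool" where
  "composition_series \<Omega> G S \<longleftrightarrow>
    op_series \<Omega> G S \<and> distinct S \<and> (\<nexists>R. proper_refinement \<Omega> G S R)"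

text \<open>Factors are counted with multiplicity, so the bijection is one between indices.\<close>

definition series_isomorphic ::
    "'w set \<Rightarrow> ('a, 'w) op_group \<Rightarrow> 'a set list \<Rightarrow> 'a set list \<Rightarrow> bool" where
  "series_isomorphic \<Omega> G S T \<longleftrightarrow>
    (\<exists>\<pi>. bij_betw \<pi> {..<length S - 1} {..<length T - 1} \<and>
      (\<forall>j<length S - 1. op_isomorphic \<Omega> (series_factor G S j) (series_factor G T (\<pi> j))))"


section \<open>Consistency of the definitions\<close>

lemma (in topological_group) subgroup_top_Aut:
  "subgroup {f \<in> auto G. homeomorphic_map (topol G) (topol G) f} (AutoGroup G)"
proof -
  let ?B = "BijGroup (carrier G)"
  let ?A = "{f \<in> auto G. homeomorphic_map (topol G) (topol G) f}"
  have B: "f \<in> Bij (carrier G)" if "f \<in> auto G" for f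
    using that by (simp add: auto_def)
  have "subgroup ?A ?B"
  proof (rule subgroup.intro)
    show "?A \<subseteq> carrier ?B"
      using subgroup.subset[OF subgroup_auto] by blast
  next
    fix x y assume x: "x \<in> ?A" and y: "y \<in> ?A"
    then have "homeomorphic_map (topol G) (topol G) (x \<circ> y)"
      using homeomorphic_map_compose by blast
    then have "homeomorphic_map (topol G) (topol G) (compose (carrier G) x y)"
      by (rule homeomorphic_map_eq) (simp add: compose_def topspace_topol)
    moreover have "x \<otimes>\<^bsub>?B\<^esub> y \<in> auto G"
      using x y subgroup.m_closed[OF subgroup_auto] by blast
    ultimately show "x \<otimes>\<^bsub>?B\<^esub> y \<in> ?A"
      using x y B by (simp add: BijGroup_def)
  next
    have "homeomorphic_map (topol G) (topol G) (\<lambda>x\<in>carrier G. x)"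
      by (rule homeomorphic_map_eq[where f = id]) (simp_all add: homeomorphic_map_id topspace_topol)
    then show "\<one>\<^bsub>?B\<^esub> \<in> ?A"
      by (simp add: BijGroup_def id_in_auto)
  next
    fix x assume x: "x \<in> ?A"
    then obtain g where g: "homeomorphic_maps (topol G) (topol G) x g"
      using homeomorphic_map_maps by blast
    have bij: "bij_betw x (carrier G) (carrier G)"
      using x B by (auto simp: Bij_def)
    have "homeomorphic_map (topol G) (topol G) (\<lambda>y\<in>carrier G. inv_into (carrier G) x y)"
    proof (rule homeomorphic_map_eq)
      show "homeomorphic_map (topol G) (topol G) g"
        using g homeomorphic_maps_map by blast
      fix y assume "y \<in> topspace (topol G)"
      then have y: "y \<in> carrier G" by (simp add: topspace_topol)
      with g have "g y \<in> carrier G" "x (g y) = y"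
        by (auto simp: homeomorphic_maps_def continuous_map_def topspace_topol)
      with bij have "inv_into (carrier G) x y = g y"
        by (intro inv_into_f_eq) (auto simp: bij_betw_def)
      with y show "g y = (\<lambda>y\<in>carrier G. inv_into (carrier G) x y) y" by simp
    qed
    moreover have "inv\<^bsub>?B\<^esub> x \<in> auto G"
      using x subgroup.m_inv_closed[OF subgroup_auto] by blast
    ultimately show "inv\<^bsub>?B\<^esub> x \<in> ?A"
      using x B by (simp add: inv_BijGroup)
  qed
  moreover have "?A \<subseteq> auto G" by blast
  ultimately show ?thesis
    unfolding AutoGroup_def
    by (rule group.subgroup_incl[OF group_BijGroup _ subgroup_auto])
qed

lemma (in topological_group) group_top_Aut: "group (top_Aut G)"
  unfolding top_Aut_def
  by (rule subgroup.subgroup_is_group[OF subgroup_top_Aut AutoGroup])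

lemma (in topological_group) topological_op_group_evaluation:
  assumes "\<Omega> \<subseteq> carrier (top_Aut G)"
  shows "topological_op_group \<Omega> (evaluation_op_group G)"
proof -
  have grp: "group (evaluation_op_group G)"
    by (rule groupI) (simp_all add: evaluation_op_group_def m_assoc l_inv_ex)
  have inv: "inv\<^bsub>evaluation_op_group G\<^esub> x = inv x" for x
    by (simp add: m_inv_def evaluation_op_group_def)
  show ?thesis
  proof (intro topological_op_group.intro topological_group.intro
      topological_group_axioms.intro topological_op_group_axioms.intro grp)
    show "topspace (topol (evaluation_op_group G)) = carrier (evaluation_op_group G)"
      by (simp add: evaluation_op_group_def topspace_topol)
    show "Hausdorff_space (topol (evaluation_op_group G))"
      by (simp add: evaluation_op_group_def Hausdorff_topol)
    show "continuous_map (prod_topology (topol (evaluation_op_group G))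
        (topol (evaluation_op_group G))) (topol (evaluation_op_group G))
        (\<lambda>(x, y). x \<otimes>\<^bsub>evaluation_op_group G\<^esub> y)"
      using continuous_mult by (simp add: evaluation_op_group_def)
    show "continuous_map (topol (evaluation_op_group G)) (topol (evaluation_op_group G))
        (\<lambda>x. inv\<^bsub>evaluation_op_group G\<^esub> x)"
      unfolding inv using continuous_inv by (simp add: evaluation_op_group_def)
  next
    fix \<omega> assume "\<omega> \<in> \<Omega>"
    with assms have "\<omega> \<in> auto G" and "homeomorphic_map (topol G) (topol G) \<omega>"
      by (auto simp: top_Aut_def)
    then show "act (evaluation_op_group G) \<omega> \<in> hom (evaluation_op_group G) (evaluation_op_group G)"
      and "continuous_map (topol (evaluation_op_group G)) (topol (evaluation_op_group G))
        (act (evaluation_op_group G) \<omega>)"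
      by (auto simp: evaluation_op_group_def auto_def hom_def homeomorphic_imp_continuous_map)
  qed
qed

lemma act_quotient_op_group:
  fixes G :: "('a, 'w) op_group"
  assumes "topological_op_group \<Omega> G" "op_subgroup \<Omega> N G" "N \<lhd> G" "\<omega> \<in> \<Omega>" "x \<in> carrier G"
  shows "act (quotient_op_group G N) \<omega> (N #>\<^bsub>G\<^esub> x) = N #>\<^bsub>G\<^esub> act G \<omega> x"
proof -
  interpret topological_op_group \<Omega> G by fact
  interpret N: normal N G by fact
  have hom: "act G \<omega> \<in> hom G G" using assms by (simp add: act_hom)
  have x': "act G \<omega> x \<in> carrier G" using hom assms(5) by (auto simp: hom_def)
  have "N #>\<^bsub>G\<^esub> act G \<omega> y = N #>\<^bsub>G\<^esub> act G \<omega> x" if "y \<in> N #>\<^bsub>G\<^esub> x" for y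
  proof -
    from that obtain n where n: "n \<in> N" "y = n \<otimes>\<^bsub>G\<^esub> x" by (auto simp: r_coset_def)
    then have "act G \<omega> y = act G \<omega> n \<otimes>\<^bsub>G\<^esub> act G \<omega> x"
      using hom assms(5) N.subset by (auto simp: hom_def)
    moreover have "act G \<omega> n \<in> N" using assms n by (auto simp: op_subgroup_def)
    ultimately have "act G \<omega> y \<in> N #>\<^bsub>G\<^esub> act G \<omega> x"
      by (auto simp: r_coset_def)
    then show ?thesis
      using repr_independence[OF _ x' N.subgroup_axioms] by simp
  qed
  then have "(\<Union>y\<in>N #>\<^bsub>G\<^esub> x. N #>\<^bsub>G\<^esub> act G \<omega> y) = (\<Union>y\<in>N #>\<^bsub>G\<^esub> x. N #>\<^bsub>G\<^esub> act G \<omega> x)"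
    by (rule SUP_cong[OF refl])
  also have "\<dots> = N #>\<^bsub>G\<^esub> act G \<omega> x"
    using rcos_self[OF assms(5) N.subgroup_axioms] by blast
  finally show ?thesis
    by (simp only: quotient_op_group_def op_group.select_convs)
qed

end

theory Submission
  imports Defs "HOL-Algebra.Zassenhaus" "HOL-Analysis.Urysohn"
begin

text \<open>
  The refinement theorem and the Jordan-Hoelder theorem rest on the Zassenhaus lemma, which is two
  applications of the second isomorphism theorem \<open>H / (H \<inter> N) \<cong> NH / N\<close>. For topological groups the
  latter can fail in two ways: \<open>NH\<close> need not be closed, and the continuous bijection between the two
  quotients need not be open. The locale \<open>product_closed_op_group\<close> collects the groups with operators
  in which neither happens, and there the classical arguments go through: interpolating each of two
  series into the other gives refinements whose factors match by the Zassenhaus lemma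
  (\<open>Schreier_refinement_theorem\<close>), and isomorphic series have their repetitions at corresponding
  places, namely at the trivial factors, so that repetitions can be deleted
  (\<open>Jordan_Hoelder_theorem\<close>).

  The contractive automorphism \<open>\<alpha>\<close> provides a compact open subgroup \<open>W\<close> with \<open>\<alpha> W \<subseteq> W\<close> whose
  images \<open>\<alpha>\<^sup>n W\<close> shrink to \<open>1\<close> and whose preimages under the powers of \<open>\<alpha>\<close> exhaust the group
  (\<open>contractive_group_exists\<close>). Such a \<open>W\<close> comes from van Dantzig's theorem and the Baire category
  theorem. The rest depends on one remark (\<open>contraction_absorb\<close>): if \<open>M \<subseteq> W\<close>, and \<open>K\<close> is a closed
  subgroup with \<open>\<alpha> K \<subseteq> K\<close> and \<open>M \<subseteq> \<alpha> M K\<close>, then iteration gives \<open>M \<subseteq> \<alpha>\<^sup>n W K\<close> for all \<open>n\<close>, hence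
  \<open>M \<subseteq> K\<close>. Consequently an \<open>\<alpha>\<close>-stable subgroup \<open>L\<close> satisfies \<open>L \<inter> W \<subseteq> K\<close> as soon as such a \<open>K \<subseteq> L\<close>
  meets the same cosets of \<open>\<alpha> W\<close> in \<open>W\<close> as \<open>L\<close> does (\<open>stable_Int_W_subset\<close>). As \<open>W\<close> is compact and
  \<open>\<alpha> W\<close> is open, there are only finitely many such cosets, and this is used twice.

  First, the number of cosets of \<open>\<alpha> W\<close> met by \<open>H \<inter> W\<close> increases strictly with the closed \<open>\<alpha>\<close>-stable
  subgroup \<open>H\<close>. So the length of series without repetitions is bounded, and a longest one is a
  composition series.

  Second, let \<open>N\<close> and \<open>H\<close> be closed and \<open>\<alpha>\<close>-stable, \<open>H\<close> normalizing \<open>N\<close>. The compact subgroups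
  \<open>{x \<in> W. \<alpha>\<^sup>n x \<in> (N \<inter> W)(H \<inter> W)}\<close> increase to \<open>NH \<inter> W\<close>, so one of them meets all cosets that
  \<open>NH\<close> meets and therefore equals \<open>NH \<inter> W\<close> (\<open>set_mult_Int_W\<close>). Thus \<open>NH\<close> is closed, and since
  some \<open>\<alpha>\<^sup>n (NH \<inter> W)\<close> lies in \<open>(N \<inter> W)(H \<inter> W)\<close>, the multiplication \<open>N \<times> H \<rightarrow> NH\<close> is open.

  Both choices of \<open>\<Omega>\<close> consist of bicontinuous automorphisms and contain \<open>\<alpha>\<close> and its inverse, so
  that \<open>\<Omega>\<close>-subgroups are closed and \<open>\<alpha>\<close>-stable; this is how \<open>\<Omega>\<close> enters the argument.
\<close>


section \<open>Isomorphisms of topological groups with operators\<close>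

lemma op_isomorphic_refl: "op_isomorphic \<Omega> G G"
  unfolding op_isomorphic_def
  by (rule bexI[where x = id]) (simp_all add: id_iso)

lemma op_isomorphic_trans:
  assumes "op_isomorphic \<Omega> G H" "op_isomorphic \<Omega> H K"
  shows "op_isomorphic \<Omega> G K"
proof -
  obtain f where f: "f \<in> iso G H" "homeomorphic_map (topol G) (topol H) f"
      "\<And>\<omega> x. \<omega> \<in> \<Omega> \<Longrightarrow> x \<in> carrier G \<Longrightarrow> f (act G \<omega> x) = act H \<omega> (f x)"
    using assms(1) unfolding op_isomorphic_def by blast
  obtain g where g: "g \<in> iso H K" "homeomorphic_map (topol H) (topol K) g"
      "\<And>\<omega> x. \<omega> \<in> \<Omega> \<Longrightarrow> x \<in> carrier H \<Longrightarrow> g (act H \<omega> x) = act K \<omega> (g x)"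
    using assms(2) unfolding op_isomorphic_def by blast
  have "f x \<in> carrier H" if "x \<in> carrier G" for x
    using f(1) that by (auto simp: iso_def bij_betw_def)
  then show ?thesis
    unfolding op_isomorphic_def
    by (intro bexI[where x = "g \<circ> f"] iso_set_trans[OF f(1) g(1)]
        conjI homeomorphic_map_compose[OF f(2) g(2)]) (simp add: f g)
qed

text \<open>The operators must preserve the carrier of \<open>G\<close>: that the inverse of \<open>f\<close> commutes with an operator
  is read off from \<open>f (act G \<omega> x) = act H \<omega> (f x)\<close>, and \<open>f\<close> can only be cancelled at points of the
  carrier.\<close>

lemma op_isomorphic_sym:
  assumes "op_isomorphic \<Omega> G H" "group G" "topspace (topol G) = carrier G"
    and act: "\<And>\<omega> x. \<omega> \<in> \<Omega> \<Longrightarrow> x \<in> carrier G \<Longrightarrow> act G \<omega> x \<in> carrier G"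
  shows "op_isomorphic \<Omega> H G"
proof -
  obtain f where f: "f \<in> iso G H" "homeomorphic_map (topol G) (topol H) f"
      "\<And>\<omega> x. \<omega> \<in> \<Omega> \<Longrightarrow> x \<in> carrier G \<Longrightarrow> f (act G \<omega> x) = act H \<omega> (f x)"
    using assms(1) unfolding op_isomorphic_def by blast
  let ?g = "inv_into (carrier G) f"
  have bij: "bij_betw f (carrier G) (carrier H)"
    using f(1) by (simp add: iso_def)
  have f_image: "f ` carrier G = carrier H"
    using bij by (simp add: bij_betw_def)
  have gf: "?g (f x) = x" if "x \<in> carrier G" for x
    using bij that by (simp add: bij_betw_def)
  obtain g' where g': "homeomorphic_maps (topol G) (topol H) f g'"
    using f(2) homeomorphic_map_maps by blast
  have homeo: "homeomorphic_map (topol H) (topol G) ?g"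
  proof (rule homeomorphic_map_eq)
    show "homeomorphic_map (topol H) (topol G) g'"
      using g' homeomorphic_maps_map by blast
    fix y assume "y \<in> topspace (topol H)"
    then have "f (g' y) = y" "g' y \<in> carrier G"
      using g' assms(3) unfolding homeomorphic_maps_def continuous_map_def by blast+
    then show "g' y = ?g y"
      using gf[of "g' y"] by simp
  qed
  have "?g (act H \<omega> y) = act G \<omega> (?g y)" if \<omega>: "\<omega> \<in> \<Omega>" and y: "y \<in> carrier H" for \<omega> y
  proof -
    obtain x where x: "x \<in> carrier G" "y = f x"
      using y f_image by blast
    then have "act H \<omega> y = f (act G \<omega> x)"
      using f(3)[OF \<omega> x(1)] by simp
    then show ?thesis
      using gf[OF x(1)] gf[OF act[OF \<omega> x(1)]] x(2) by simp
  qed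
  then show ?thesis
    unfolding op_isomorphic_def
    using homeo by (intro bexI[OF _ group.iso_set_sym[OF assms(2) f(1)]]) simp
qed


section \<open>Factors of subgroups\<close>

abbreviation factor :: "('a, 'w) op_group \<Rightarrow> 'a set \<Rightarrow> 'a set \<Rightarrow> ('a set, 'w) op_group" where
  "factor G A N \<equiv> quotient_op_group (induced_op_group G A) N"

text \<open>In contrast to normality of \<open>N\<close> in \<open>H\<close>, the subgroup \<open>N\<close> is not required to lie in \<open>H\<close>; this is the
  situation of the second isomorphism theorem.\<close>

definition normalizes :: "('a, 'b) monoid_scheme \<Rightarrow> 'a set \<Rightarrow> 'a set \<Rightarrow> bool" where
  "normalizes G H N \<longleftrightarrow> (\<forall>h\<in>H. \<forall>n\<in>N. h \<otimes>\<^bsub>G\<^esub> n \<otimes>\<^bsub>G\<^esub> inv\<^bsub>G\<^esub> h \<in> N)"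

lemma carrier_factor: "carrier (factor G A N) = (\<lambda>x. N #>\<^bsub>G\<^esub> x) ` A"
  by (auto simp: quotient_op_group_def induced_op_group_def FactGroup_def RCOSETS_def r_coset_def)

lemma mult_factor: "monoid.mult (factor G A N) = (<#>\<^bsub>G\<^esub>)"
  by (intro ext) (simp add: quotient_op_group_def induced_op_group_def FactGroup_def set_mult_def)

lemma topol_factor:
  "topol (factor G A N) = quotient_topology (subtopology (topol G) A) (\<lambda>x. N #>\<^bsub>G\<^esub> x)"
  by (simp add: quotient_op_group_def induced_op_group_def r_coset_def)

lemma act_factor: "act (factor G A N) \<omega> C = (\<Union>x\<in>C. N #>\<^bsub>G\<^esub> act G \<omega> x)"
  by (simp add: quotient_op_group_def induced_op_group_def r_coset_def)

lemma openin_topol_factor: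
  assumes "A \<subseteq> topspace (topol G)"
  shows "openin (topol (factor G A N)) U \<longleftrightarrow>
    U \<subseteq> carrier (factor G A N) \<and> openin (subtopology (topol G) A) {x \<in> A. N #>\<^bsub>G\<^esub> x \<in> U}"
proof -
  have "topspace (subtopology (topol G) A) = A"
    using assms by (simp add: Int_absorb1)
  then show ?thesis
    by (simp only: topol_factor openin_quotient_topology carrier_factor)
qed

context group
begin

lemma normalizes_mono: "normalizes G H N \<Longrightarrow> K \<subseteq> H \<Longrightarrow> normalizes G K N"
  by (auto simp: normalizes_def)

lemma normal_imp_normalizes:
  assumes "subgroup H G" "N \<lhd> G\<lparr>carrier := H\<rparr>"
  shows "normalizes G H N"
  unfolding normalizes_def
proof (intro ballI)
  fix h n assume h: "h \<in> H" and n: "n \<in> N"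
  have "h \<otimes>\<^bsub>G\<lparr>carrier := H\<rparr>\<^esub> n \<otimes>\<^bsub>G\<lparr>carrier := H\<rparr>\<^esub> inv\<^bsub>G\<lparr>carrier := H\<rparr>\<^esub> h \<in> N"
    using normal.inv_op_closed2[OF assms(2)] h n by simp
  then show "h \<otimes> n \<otimes> inv h \<in> N"
    using m_inv_consistent[OF assms(1) h] by simp
qed

lemma rcos_mult:
  assumes "subgroup N G" "normalizes G H N" "H \<subseteq> carrier G" "h \<in> H" "k \<in> carrier G"
  shows "(N #> h) <#> (N #> k) = N #> (h \<otimes> k)"
proof -
  have h: "h \<in> carrier G" and NG: "\<And>n. n \<in> N \<Longrightarrow> n \<in> carrier G"
    using assms subgroup.mem_carrier by auto
  have "(n \<otimes> h) \<otimes> (n' \<otimes> k) \<in> N #> (h \<otimes> k)" if "n \<in> N" "n' \<in> N" for n n'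
  proof -
    have "inv h \<otimes> (h \<otimes> k) = k"
      using h assms(5) by (simp flip: m_assoc)
    then have "(n \<otimes> h) \<otimes> (n' \<otimes> k) = (n \<otimes> (h \<otimes> n' \<otimes> inv h)) \<otimes> (h \<otimes> k)"
      using NG that h assms(5) by (simp add: m_assoc)
    moreover have "n \<otimes> (h \<otimes> n' \<otimes> inv h) \<in> N"
      using assms that by (auto simp: normalizes_def intro: subgroup.m_closed)
    ultimately show ?thesis
      by (auto simp: r_coset_def)
  qed
  then have "(N #> h) <#> (N #> k) \<subseteq> N #> (h \<otimes> k)"
    by (auto simp: r_coset_def set_mult_def)
  moreover have "N #> (h \<otimes> k) \<subseteq> (N #> h) <#> (N #> k)"
  proof
    fix x assume "x \<in> N #> (h \<otimes> k)"
    then obtain n where n: "n \<in> N" "x = n \<otimes> (h \<otimes> k)"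
      by (auto simp: r_coset_def)
    then have "x = (n \<otimes> h) \<otimes> k"
      using NG h assms(5) by (simp add: m_assoc)
    moreover have "n \<otimes> h \<in> N #> h" "k \<in> N #> k"
      using n(1) rcos_self[OF assms(5,1)] by (auto simp: r_coset_def)
    ultimately show "x \<in> (N #> h) <#> (N #> k)"
      by (auto simp: set_mult_def)
  qed
  ultimately show ?thesis
    by blast
qed

lemma rcos_eq_iff:
  assumes "subgroup N G" "x \<in> carrier G" "y \<in> carrier G"
  shows "N #> x = N #> y \<longleftrightarrow> x \<otimes> inv y \<in> N"
proof
  assume "N #> x = N #> y"
  then have "x \<in> N #> y"
    using rcos_self[OF assms(2,1)] by simp
  then show "x \<otimes> inv y \<in> N"
    using assms subgroup.mem_carrier[OF assms(1)] by (auto simp: r_coset_def m_assoc)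
next
  assume xy: "x \<otimes> inv y \<in> N"
  have "x = (x \<otimes> inv y) \<otimes> y"
    using assms by (simp add: m_assoc)
  then have "x \<in> N #> y"
    using xy unfolding r_coset_def by blast
  then show "N #> x = N #> y"
    using repr_independence[OF _ assms(3,1)] by simp
qed

lemma subgroup_set_mult_normalized:
  assumes "subgroup N G" "subgroup H G" "normalizes G H N"
  shows "subgroup (N <#> H) G"
proof (rule subgroupI)
  have NG: "\<And>n. n \<in> N \<Longrightarrow> n \<in> carrier G" and HG: "\<And>h. h \<in> H \<Longrightarrow> h \<in> carrier G"
    using assms by (auto dest: subgroup.mem_carrier)
  show "N <#> H \<subseteq> carrier G"
    using NG HG by (auto simp: set_mult_def)
  show "N <#> H \<noteq> {}"
    using assms subgroup.one_closed by (auto simp: set_mult_def)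
  fix a assume "a \<in> N <#> H"
  then obtain n h where a: "a = n \<otimes> h" "n \<in> N" "h \<in> H" by (auto simp: set_mult_def)
  have ih: "inv h \<in> H" "inv n \<in> N" using a assms by (auto simp: subgroup.m_inv_closed)
  have "inv a = (inv h \<otimes> inv n \<otimes> inv (inv h)) \<otimes> inv h"
    using a NG HG by (simp add: inv_mult_group m_assoc)
  moreover have "inv h \<otimes> inv n \<otimes> inv (inv h) \<in> N"
    using ih assms(3) unfolding normalizes_def by blast
  ultimately show "inv a \<in> N <#> H"
    using ih(1) by (auto simp: set_mult_def)
  fix b assume "b \<in> N <#> H"
  then obtain n' h' where b: "b = n' \<otimes> h'" "n' \<in> N" "h' \<in> H" by (auto simp: set_mult_def)
  have "a \<otimes> b \<in> (N #> h) <#> (N #> h')"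
    using a b by (auto simp: set_mult_def r_coset_def)
  also have "\<dots> = N #> (h \<otimes> h')"
    using rcos_mult[OF assms(1,3)] a b HG assms(2) subgroup.subset by blast
  finally show "a \<otimes> b \<in> N <#> H"
    using subgroup.m_closed[OF assms(2) a(3) b(3)] by (auto simp: set_mult_def r_coset_def)
qed

end

lemma group_factor:
  assumes "N \<lhd> G\<lparr>carrier := A\<rparr>"
  shows "group (factor G A N)"
proof -
  interpret F: group "G\<lparr>carrier := A\<rparr> Mod N"
    using normal.factorgroup_is_group[OF assms] .
  have eqs: "carrier (factor G A N) = carrier (G\<lparr>carrier := A\<rparr> Mod N)"
      "monoid.mult (factor G A N) = monoid.mult (G\<lparr>carrier := A\<rparr> Mod N)"
      "one (factor G A N) = one (G\<lparr>carrier := A\<rparr> Mod N)"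
    by (auto simp: quotient_op_group_def induced_op_group_def FactGroup_def RCOSETS_def
        r_coset_def set_mult_def fun_eq_iff)
  show ?thesis
    by (rule groupI; simp only: eqs;
        ((rule F.one_closed) | (rule F.m_closed F.m_assoc F.l_one F.l_inv_ex; assumption)))
qed

context topological_op_group
begin

lemma op_subgroup_carrier: "op_subgroup \<Omega> (carrier G) G"
  using act_hom closedin_topspace[of "topol G"]
  by (auto simp: op_subgroup_def subgroup_self hom_def topspace_topol)

lemma op_subgroup_one: "op_subgroup \<Omega> {\<one>} G"
proof -
  have "closedin (topol G) {\<one>}"
    using Hausdorff_topol by (simp add: closedin_Hausdorff_singleton topspace_topol)
  moreover have "act G \<omega> \<one> = \<one>" if "\<omega> \<in> \<Omega>" for \<omega>
    using hom_one[OF act_hom[OF that]] is_group by blast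
  ultimately show ?thesis
    by (auto simp: op_subgroup_def triv_subgroup)
qed

lemma op_subgroup_Int:
  "op_subgroup \<Omega> H G \<Longrightarrow> op_subgroup \<Omega> K G \<Longrightarrow> op_subgroup \<Omega> (H \<inter> K) G"
  by (auto simp: op_subgroup_def subgroups_Inter_pair)

text \<open>An operator acts on cosets through representatives, because it maps \<open>N\<close> into itself.\<close>

lemma act_factor_rcos:
  assumes "op_subgroup \<Omega> N G" "\<omega> \<in> \<Omega>" "x \<in> carrier G"
  shows "(\<Union>y\<in>N #> x. N #> act G \<omega> y) = N #> act G \<omega> x"
proof -
  have N: "subgroup N G" using assms by (simp add: op_subgroup_def)
  have x': "act G \<omega> x \<in> carrier G" using act_hom assms by (auto simp: hom_def)
  have "N #> act G \<omega> y = N #> act G \<omega> x" if "y \<in> N #> x" for y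
  proof -
    from that obtain n where n: "n \<in> N" "y = n \<otimes> x" by (auto simp: r_coset_def)
    then have "act G \<omega> y = act G \<omega> n \<otimes> act G \<omega> x"
      using act_hom[OF assms(2)] assms(3) subgroup.mem_carrier[OF N] by (auto simp: hom_def)
    moreover have "act G \<omega> n \<in> N" using assms n by (auto simp: op_subgroup_def)
    ultimately have "act G \<omega> y \<in> N #> act G \<omega> x"
      by (auto simp: r_coset_def)
    then show ?thesis
      using repr_independence[OF _ x' N] by simp
  qed
  then show ?thesis
    using rcos_self[OF assms(3) N] by blast
qed

end

lemma op_isomorphic_factor_sym:
  fixes G :: "('a, 'w) op_group"
  assumes "topological_op_group \<Omega> G" "op_subgroup \<Omega> A G" "op_subgroup \<Omega> N G" 
    "N \<lhd> G\<lparr>carrier := A\<rparr>"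
    "op_isomorphic \<Omega> (factor G A N) K"
  shows "op_isomorphic \<Omega> K (factor G A N)"
proof (rule op_isomorphic_sym[OF assms(5)])
  interpret topological_op_group \<Omega> G by fact
  have A: "A \<subseteq> carrier G"
    using assms(2) by (auto simp: op_subgroup_def subgroup.subset)
  show "group (factor G A N)"
    using assms(4) by (rule group_factor)
  show "topspace (topol (factor G A N)) = carrier (factor G A N)"
    using A by (simp add: topol_factor carrier_factor topspace_topol Int_absorb1)
  show "\<And>\<omega> x. \<omega> \<in> \<Omega> \<Longrightarrow> x \<in> carrier (factor G A N) \<Longrightarrow>
      act (factor G A N) \<omega> x \<in> carrier (factor G A N)"
    using act_factor_rcos[OF assms(3)] assms(2) A
    by (auto simp: carrier_factor act_factor op_subgroup_def)
qed


section \<open>The second isomorphism theorem and the Zassenhaus lemma\<close>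

text \<open>Products of closed subgroups of a topological group need not be closed, and even a closed product
  \<open>NH\<close> may carry a topology that is strictly coarser than the one coming from \<open>N \<times> H\<close>. These are exactly
  the obstructions to the second isomorphism theorem, and both are excluded here.\<close>

locale product_closed_op_group = topological_op_group \<Omega> G
  for \<Omega> :: "'w set" and G :: "('a, 'w) op_group" (structure) +
  assumes closedin_set_mult:
      "\<lbrakk>op_subgroup \<Omega> N G; op_subgroup \<Omega> H G; normalizes G H N\<rbrakk>
        \<Longrightarrow> closedin (topol G) (N <#> H)"
    and openin_set_mult:
      "\<lbrakk>op_subgroup \<Omega> N G; op_subgroup \<Omega> H G; normalizes G H N;
          openin (subtopology (topol G) H) U\<rbrakk>
        \<Longrightarrow> openin (subtopology (topol G) (N <#> H)) (N <#> U)"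
begin

lemma op_subgroup_set_mult:
  assumes "op_subgroup \<Omega> N G" "op_subgroup \<Omega> H G" "normalizes G H N"
  shows "op_subgroup \<Omega> (N <#> H) G"
proof -
  have sub: "N \<subseteq> carrier G" "H \<subseteq> carrier G"
    using assms by (auto simp: op_subgroup_def subgroup.subset)
  have "act G \<omega> x \<in> N <#> H" if \<omega>: "\<omega> \<in> \<Omega>" and x: "x \<in> N <#> H" for \<omega> x
  proof -
    obtain n h where nh: "n \<in> N" "h \<in> H" "x = n \<otimes> h"
      using x by (auto simp: set_mult_def)
    have "act G \<omega> x = act G \<omega> n \<otimes> act G \<omega> h"
      using hom_mult[OF act_hom[OF \<omega>]] nh sub by blast
    moreover have "act G \<omega> n \<in> N" "act G \<omega> h \<in> H"
      using assms \<omega> nh by (auto simp: op_subgroup_def)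
    ultimately show ?thesis
      by (auto simp: set_mult_def)
  qed
  then show ?thesis
    using assms closedin_set_mult subgroup_set_mult_normalized by (auto simp: op_subgroup_def)
qed

text \<open>The isomorphism sends the coset of \<open>h\<close> modulo \<open>H \<inter> N\<close> to \<open>N #> h\<close>. It is written as \<open>C \<mapsto> N <#> C\<close>, which
  is meaningful without a choice of representatives. Continuity is automatic; openness is where the
  openness of the multiplication \<open>N \<times> H \<rightarrow> NH\<close> is needed.\<close>

theorem second_isomorphism:
  assumes N: "op_subgroup \<Omega> N G" and H: "op_subgroup \<Omega> H G" and norm: "normalizes G H N"
  shows "op_isomorphic \<Omega> (factor G H (H \<inter> N)) (factor G (N <#> H) N)"
proof -
  let ?M = "H \<inter> N" and ?L = "N <#> H"
  have sub: "subgroup N G" "subgroup H G" "subgroup ?M G" "subgroup ?L G"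
    using N H subgroup_set_mult_normalized[OF _ _ norm] by (auto simp: op_subgroup_def subgroups_Inter_pair)
  have NG: "N \<subseteq> carrier G" and HG: "H \<subseteq> carrier G" and LG: "?L \<subseteq> carrier G"
    using sub subgroup.subset by blast+
  have normM: "normalizes G H ?M"
    using norm sub(2) subgroup.m_closed subgroup.m_inv_closed
    unfolding normalizes_def by (metis Int_iff)
  have HL: "H \<subseteq> ?L"
  proof
    fix h assume h: "h \<in> H"
    then have "h = \<one> \<otimes> h" using HG by auto
    then show "h \<in> ?L"
      using h subgroup.one_closed[OF sub(1)] unfolding set_mult_def by blast
  qed
  define f where "f = (\<lambda>C. N <#> C)"
  have f_rcos: "f (?M #> h) = N #> h" if "h \<in> H" for h
  proof -
    have "N <#> ?M = N"
    proof
      show "N <#> ?M \<subseteq> N"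
        using subgroup.m_closed[OF sub(1)] by (auto simp: set_mult_def)
      have "n = n \<otimes> \<one>" if "n \<in> N" for n
        using that NG by auto
      then show "N \<subseteq> N <#> ?M"
        using subgroup.one_closed[OF sub(3)] unfolding set_mult_def by blast
    qed
    then show ?thesis
      using setmult_rcos_assoc[of N ?M h] NG HG that by (auto simp: f_def)
  qed
  have rcos_L: "\<exists>h\<in>H. N #> x = N #> h" if x: "x \<in> ?L" for x
  proof -
    obtain n h where nh: "n \<in> N" "h \<in> H" "x = n \<otimes> h"
      using x by (auto simp: set_mult_def)
    then have "x \<in> N #> h" by (auto simp: r_coset_def)
    then show ?thesis
      using repr_independence[OF _ _ sub(1)] nh HG by blast
  qed
  let ?Q = "factor G H ?M" and ?R = "factor G ?L N"
  have hom: "f \<in> hom ?Q ?R"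
  proof (rule homI)
    show "f C \<in> carrier ?R" if "C \<in> carrier ?Q" for C
      using that HL f_rcos by (auto simp: carrier_factor)
    fix C D assume "C \<in> carrier ?Q" "D \<in> carrier ?Q"
    then obtain h k where hk: "h \<in> H" "k \<in> H" "C = ?M #> h" "D = ?M #> k"
      by (auto simp: carrier_factor)
    have "C <#> D = ?M #> (h \<otimes> k)"
      using rcos_mult[OF sub(3) normM HG hk(1)] hk HG by auto
    moreover have "f C <#> f D = N #> (h \<otimes> k)"
      using rcos_mult[OF sub(1) norm HG hk(1)] hk HG f_rcos by auto
    ultimately show "f (C \<otimes>\<^bsub>?Q\<^esub> D) = f C \<otimes>\<^bsub>?R\<^esub> f D"
      using f_rcos[OF subgroup.m_closed[OF sub(2) hk(1,2)]] by (simp add: mult_factor)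
  qed
  have inj: "inj_on f (carrier ?Q)"
  proof (rule inj_onI)
    fix C D assume "C \<in> carrier ?Q" "D \<in> carrier ?Q" and eq: "f C = f D"
    then obtain h k where hk: "h \<in> H" "k \<in> H" "C = ?M #> h" "D = ?M #> k"
      by (auto simp: carrier_factor)
    have "h \<otimes> inv k \<in> N"
      using eq hk f_rcos rcos_eq_iff[OF sub(1), of h k] HG by auto
    moreover have "h \<otimes> inv k \<in> H"
      using hk sub(2) by (simp add: subgroup.m_closed subgroup.m_inv_closed)
    ultimately show "C = D"
      using hk rcos_eq_iff[OF sub(3), of h k] HG by auto
  qed
  have img: "f ` carrier ?Q = carrier ?R"
  proof
    show "f ` carrier ?Q \<subseteq> carrier ?R"
      using hom by (auto simp: hom_def)
    show "carrier ?R \<subseteq> f ` carrier ?Q"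
    proof
      fix C assume "C \<in> carrier ?R"
      then obtain h where "h \<in> H" "C = N #> h"
        using rcos_L by (auto simp: carrier_factor)
      then show "C \<in> f ` carrier ?Q"
        using f_rcos by (auto simp: carrier_factor intro!: image_eqI)
    qed
  qed
  have tops: "topspace (subtopology (topol G) H) = H" "topspace (subtopology (topol G) ?L) = ?L"
    using HG LG by (auto simp: topspace_topol)
  have openQ: "openin (topol ?Q) U \<longleftrightarrow>
      U \<subseteq> carrier ?Q \<and> openin (subtopology (topol G) H) {h \<in> H. ?M #> h \<in> U}" for U
    by (rule openin_topol_factor) (simp add: topspace_topol HG)
  have openR: "openin (topol ?R) V \<longleftrightarrow>
      V \<subseteq> carrier ?R \<and> openin (subtopology (topol G) ?L) {x \<in> ?L. N #> x \<in> V}" for V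
    by (rule openin_topol_factor) (simp add: topspace_topol LG)
  have topQ: "topspace (topol ?Q) = carrier ?Q" and topR: "topspace (topol ?R) = carrier ?R"
    using tops by (simp_all add: topol_factor carrier_factor)
  have cont: "continuous_map (topol ?Q) (topol ?R) f"
    unfolding continuous_map_alt
  proof (intro conjI allI impI)
    show "f \<in> topspace (topol ?Q) \<rightarrow> topspace (topol ?R)"
      using img topQ topR by auto
    fix V assume V: "openin (topol ?R) V"
    have "openin (subtopology (topol G) ?L) {x \<in> ?L. N #> x \<in> V}"
      using V by (simp add: openR)
    then have "openin (subtopology (topol G) H) (H \<inter> {x \<in> ?L. N #> x \<in> V})"
      using HL by (metis openin_subtopology_Int2 subtopology_subtopology inf.absorb_iff2)
    moreover have "H \<inter> {x \<in> ?L. N #> x \<in> V} = {h \<in> H. ?M #> h \<in> f -` V \<inter> carrier ?Q}"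
      using HL f_rcos by (auto simp: carrier_factor)
    ultimately show "openin (topol ?Q) (f -` V \<inter> topspace (topol ?Q))"
      unfolding topQ openQ by simp
  qed
  have "open_map (topol ?Q) (topol ?R) f"
    unfolding open_map_def
  proof (intro allI impI)
    fix U assume U: "openin (topol ?Q) U"
    then have UQ: "U \<subseteq> carrier ?Q"
      using openin_subset topQ by blast
    let ?U = "{h \<in> H. ?M #> h \<in> U}"
    have "openin (subtopology (topol G) H) ?U"
      using U by (simp add: openQ)
    then have "openin (subtopology (topol G) ?L) (N <#> ?U)"
      by (rule openin_set_mult[OF N H norm])
    moreover have "N <#> ?U = {x \<in> ?L. N #> x \<in> f ` U}"
    proof
      show "N <#> ?U \<subseteq> {x \<in> ?L. N #> x \<in> f ` U}"
      proof
        fix x assume "x \<in> N <#> ?U"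
        then obtain n h where nh: "n \<in> N" "h \<in> H" "?M #> h \<in> U" "x = n \<otimes> h"
          by (auto simp: set_mult_def)
        then have "x \<in> N #> h" by (auto simp: r_coset_def)
        then have "N #> x = N #> h"
          using repr_independence[OF _ _ sub(1)] nh HG by blast
        then show "x \<in> {x \<in> ?L. N #> x \<in> f ` U}"
          using nh f_rcos[OF nh(2)] by (force simp: set_mult_def)
      qed
      show "{x \<in> ?L. N #> x \<in> f ` U} \<subseteq> N <#> ?U"
      proof
        fix x assume x: "x \<in> {x \<in> ?L. N #> x \<in> f ` U}"
        then obtain C where "C \<in> U" "N #> x = f C" by auto
        then obtain h where h: "h \<in> H" "?M #> h \<in> U" "N #> x = N #> h"
          using UQ f_rcos by (auto simp: carrier_factor)
        have "x \<in> N #> h"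
          using h rcos_self[OF _ sub(1)] x LG by blast
        then show "x \<in> N <#> ?U"
          using h by (auto simp: r_coset_def set_mult_def)
      qed
    qed
    moreover have "f ` U \<subseteq> carrier ?R"
      using img UQ by blast
    ultimately show "openin (topol ?R) (f ` U)"
      unfolding openR by simp
  qed
  then have "homeomorphic_map (topol ?Q) (topol ?R) f"
    using cont img inj by (simp add: bijective_open_imp_homeomorphic_map topQ topR)
  moreover have "f (act ?Q \<omega> C) = act ?R \<omega> (f C)" if \<omega>: "\<omega> \<in> \<Omega>" and C: "C \<in> carrier ?Q" for \<omega> C
  proof -
    obtain h where h: "h \<in> H" "C = ?M #> h"
      using C by (auto simp: carrier_factor)
    have hG: "h \<in> carrier G" and h': "act G \<omega> h \<in> H"
      using h HG H \<omega> by (auto simp: op_subgroup_def)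
    have "act ?Q \<omega> C = ?M #> act G \<omega> h"
      using act_factor_rcos[OF op_subgroup_Int[OF H N] \<omega> hG] h by (simp add: act_factor)
    moreover have "act ?R \<omega> (f C) = N #> act G \<omega> h"
      using act_factor_rcos[OF N \<omega> hG] h f_rcos by (simp add: act_factor)
    ultimately show ?thesis
      using f_rcos[OF h'] by simp
  qed
  moreover have "f \<in> iso ?Q ?R"
    using hom inj img by (simp add: iso_iff)
  ultimately show ?thesis
    unfolding op_isomorphic_def by blast
qed

lemma op_subgroup_Zassenhaus:
  assumes "op_subgroup \<Omega> A G" "op_subgroup \<Omega> A' G" "A' \<lhd> G\<lparr>carrier := A\<rparr>"
    and "op_subgroup \<Omega> C G"
  shows "op_subgroup \<Omega> (A' <#> (A \<inter> C)) G"
proof (rule op_subgroup_set_mult[OF assms(2)])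
  show "op_subgroup \<Omega> (A \<inter> C) G"
    using assms by (simp add: op_subgroup_Int)
  show "normalizes G (A \<inter> C) A'"
    using assms(1) by (intro normalizes_mono[OF normal_imp_normalizes[OF _ assms(3)]])
      (simp_all add: op_subgroup_def)
qed

text \<open>This is the second isomorphism theorem for \<open>H = A \<inter> B\<close> and \<open>N = A' (A \<inter> B')\<close>: then \<open>NH = A' (A \<inter> B)\<close>, and
  \<open>H \<inter> N = (A' \<inter> B) (A \<inter> B')\<close> by Dedekind's modular law.\<close>

lemma Zassenhaus_half:
  assumes A: "op_subgroup \<Omega> A G" "op_subgroup \<Omega> A' G" "A' \<lhd> G\<lparr>carrier := A\<rparr>"
    and B: "op_subgroup \<Omega> B G" "op_subgroup \<Omega> B' G" "B' \<lhd> G\<lparr>carrier := B\<rparr>"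
  shows "op_isomorphic \<Omega> (factor G (A' <#> (A \<inter> B)) (A' <#> (A \<inter> B')))
    (factor G (A \<inter> B) ((A' \<inter> B) <#> (A \<inter> B')))"
proof -
  let ?N = "A' <#> (A \<inter> B')"
  have sub: "subgroup A G" "subgroup B G" "subgroup A' G" "subgroup B' G"
    using A B by (auto simp: op_subgroup_def)
  have N: "op_subgroup \<Omega> ?N G"
    using op_subgroup_Zassenhaus[OF A B(2)] .
  have L: "op_subgroup \<Omega> (A' <#> (A \<inter> B)) G"
    using op_subgroup_Zassenhaus[OF A B(1)] .
  have B'B: "B' \<subseteq> B"
    using normal_imp_subgroup[OF B(3)] subgroup.subset by fastforce
  have GS: "A \<subseteq> carrier G" "A' \<subseteq> carrier G" "B' \<subseteq> carrier G" "B \<subseteq> carrier G"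
    using sub subgroup.subset by blast+
  have sub_L: "A \<inter> B \<subseteq> A' <#> (A \<inter> B)"
  proof
    fix x assume x: "x \<in> A \<inter> B"
    then have "x = \<one> \<otimes> x" using GS by auto
    then show "x \<in> A' <#> (A \<inter> B)"
      using x subgroup.one_closed[OF sub(3)] unfolding set_mult_def by blast
  qed
  have norm: "normalizes G (A \<inter> B) ?N"
    using L by (intro normalizes_mono[OF _ sub_L]
        normal_imp_normalizes[OF _ preliminary2[OF sub(1) A(3) sub(2) B(3)]])
      (simp add: op_subgroup_def)
  have "(A \<inter> B') <#> (A \<inter> B) = A \<inter> B"
  proof
    show "(A \<inter> B') <#> (A \<inter> B) \<subseteq> A \<inter> B"
      using B'B subgroup.m_closed[OF sub(1)] subgroup.m_closed[OF sub(2)]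
      by (auto simp: set_mult_def)
    show "A \<inter> B \<subseteq> (A \<inter> B') <#> (A \<inter> B)"
    proof
      fix x assume x: "x \<in> A \<inter> B"
      then have "x = \<one> \<otimes> x" using GS by auto
      then show "x \<in> (A \<inter> B') <#> (A \<inter> B)"
        using x sub subgroup.one_closed unfolding set_mult_def by blast
    qed
  qed
  then have "?N <#> (A \<inter> B) = A' <#> (A \<inter> B)"
    using set_mult_assoc[of A' "A \<inter> B'" "A \<inter> B"] GS by auto
  then have iso: "op_isomorphic \<Omega> (factor G (A \<inter> B) (A \<inter> B \<inter> ?N)) (factor G (A' <#> (A \<inter> B)) ?N)"
    using second_isomorphism[OF N op_subgroup_Int[OF A(1) B(1)] norm] by simp
  have "?N \<inter> (A \<inter> B) \<lhd> G\<lparr>carrier := (A' <#> (A \<inter> B)) \<inter> (A \<inter> B)\<rparr>"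
    using L normal_inter[OF _ subgroups_Inter_pair[OF sub(1,2)]
        preliminary2[OF sub(1) A(3) sub(2) B(3)]] by (simp add: op_subgroup_def)
  moreover have "(A' <#> (A \<inter> B)) \<inter> (A \<inter> B) = A \<inter> B"
    using sub_L by blast
  ultimately have "A \<inter> B \<inter> ?N \<lhd> G\<lparr>carrier := A \<inter> B\<rparr>"
    by (simp add: Int_commute)
  then have "op_isomorphic \<Omega> (factor G (A' <#> (A \<inter> B)) ?N) (factor G (A \<inter> B) (A \<inter> B \<inter> ?N))"
    using op_isomorphic_factor_sym[OF topological_op_group_axioms _ _ _ iso]
      op_subgroup_Int A(1) B(1) N by blast
  then show ?thesis
    using preliminary1[OF sub(1) A(3) sub(2) B(3)] by simp
qed

text \<open>The group in the middle, \<open>A \<inter> B\<close> modulo \<open>(A' \<inter> B) (A \<inter> B')\<close>, is symmetric in the two pairs, since the two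
  factors of the denominator commute as sets.\<close>

theorem Zassenhaus_op:
  assumes A: "op_subgroup \<Omega> A G" "op_subgroup \<Omega> A' G" "A' \<lhd> G\<lparr>carrier := A\<rparr>"
    and B: "op_subgroup \<Omega> B G" "op_subgroup \<Omega> B' G" "B' \<lhd> G\<lparr>carrier := B\<rparr>"
  shows "op_isomorphic \<Omega> (factor G (A' <#> (A \<inter> B)) (A' <#> (A \<inter> B')))
    (factor G (B' <#> (B \<inter> A)) (B' <#> (B \<inter> A')))"
proof -
  have sub: "subgroup A G" "subgroup B G" "subgroup A' G" "subgroup B' G"
    using A B by (auto simp: op_subgroup_def)
  have B'B: "B' \<inter> A \<lhd> G\<lparr>carrier := A \<inter> B\<rparr>"
    using normal_inter[OF sub(2,1) B(3)] by (simp add: Int_commute)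
  have A'B: "subgroup (A' \<inter> B) (G\<lparr>carrier := A \<inter> B\<rparr>)"
    using normal_inter[OF sub(1,2) A(3)] by (simp add: normal_imp_subgroup)
  have "(A' \<inter> B) <#> (A \<inter> B') = (B' \<inter> A) <#> (B \<inter> A')"
    using commut_normal_subgroup[OF subgroups_Inter_pair[OF sub(1,2)] B'B A'B]
    by (simp add: Int_commute)
  then have iso: "op_isomorphic \<Omega> (factor G (B' <#> (B \<inter> A)) (B' <#> (B \<inter> A')))
      (factor G (A \<inter> B) ((A' \<inter> B) <#> (A \<inter> B')))"
    using Zassenhaus_half[OF B A] by (simp add: Int_commute)
  have "op_isomorphic \<Omega> (factor G (A \<inter> B) ((A' \<inter> B) <#> (A \<inter> B')))
      (factor G (B' <#> (B \<inter> A)) (B' <#> (B \<inter> A')))"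
    using op_isomorphic_factor_sym[OF topological_op_group_axioms _ _ _ iso]
      op_subgroup_Zassenhaus[OF B A(1)] op_subgroup_Zassenhaus[OF B A(2)]
      preliminary2[OF sub(2) B(3) sub(1) A(3)] by blast
  then show ?thesis
    using Zassenhaus_half[OF A B] op_isomorphic_trans by blast
qed

end


section \<open>Lists without adjacent repetitions\<close>

text \<open>Deleting adjacent repetitions keeps exactly the pairs of consecutive distinct entries. For a series
  these are the non-trivial factors, which is how factors of a series are compared with those of the
  series without its repetitions.\<close>

lemma bij_betw_changes_remdups_adj:
  defines "changes \<equiv> \<lambda>xs. {j. Suc j < length xs \<and> xs ! j \<noteq> xs ! Suc j}"
  shows "\<exists>f. bij_betw f (changes xs) {..<length (remdups_adj xs) - 1} \<and>
    (\<forall>j\<in>changes xs. remdups_adj xs ! f j = xs ! j \<and> remdups_adj xs ! Suc (f j) = xs ! Suc j)"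
proof -
  define ys where "ys = remdups_adj xs"
  obtain f :: "nat \<Rightarrow> nat" where mono: "mono f" and img: "f ` {0..<length xs} = {0..<length ys}"
    and nth: "\<And>i. i < length xs \<Longrightarrow> xs ! i = ys ! f i"
    and eq: "\<And>i. Suc i < length xs \<Longrightarrow> xs ! i = xs ! Suc i \<longleftrightarrow> f i = f (Suc i)"
    using remdups_adj_altdef[of xs ys] unfolding ys_def Suc_eq_plus1 by blast
  have less: "f i < length ys" if "i < length xs" for i
    using img that by fastforce
  have ex: "\<exists>i<length xs. f i = l" if "l < length ys" for l
  proof -
    have "l \<in> f ` {0..<length xs}" using img that by simp
    then show ?thesis by auto
  qed
  have jump: "f (Suc j) = Suc (f j)" if j: "j \<in> changes xs" for j
  proof -
    have j': "Suc j < length xs" "f j \<noteq> f (Suc j)"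
      using j eq by (auto simp: changes_def)
    then have "f j < f (Suc j)"
      using monoD[OF mono, of j "Suc j"] by simp
    moreover have "\<not> Suc (f j) < f (Suc j)"
    proof
      assume "Suc (f j) < f (Suc j)"
      then obtain i where i: "f i = Suc (f j)"
        using ex less[OF j'(1)] by (metis less_trans)
      show False
        using i \<open>Suc (f j) < f (Suc j)\<close> monoD[OF mono, of i j] monoD[OF mono, of "Suc j" i]
        by (cases "i \<le> j") auto
    qed
    ultimately show ?thesis by simp
  qed
  have "inj_on f (changes xs)"
  proof (rule linorder_inj_onI)
    fix j k :: nat assume "j < k" "j \<in> changes xs" "k \<in> changes xs"
    then show "f j \<noteq> f k"
      using jump[of j] monoD[OF mono, of "Suc j" k] by auto
  qed auto
  moreover have "f ` changes xs = {..<length ys - 1}"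
  proof
    show "f ` changes xs \<subseteq> {..<length ys - 1}"
    proof
      fix l assume "l \<in> f ` changes xs"
      then obtain j where "j \<in> changes xs" "l = f j" by blast
      then have "Suc l < length ys"
        using jump[of j] less[of "Suc j"] by (simp add: changes_def)
      then show "l \<in> {..<length ys - 1}" by auto
    qed
    show "{..<length ys - 1} \<subseteq> f ` changes xs"
    proof
      fix l assume "l \<in> {..<length ys - 1}"
      then have l: "Suc l < length ys" by auto
      obtain i where i: "i < length xs" "f i = l" using ex l by (metis Suc_lessD)
      obtain i' where i': "i' < length xs" "f i' = Suc l" using ex l by metis
      \<comment> \<open>the index just before the first one with value \<open>Suc l\<close>\<close>
      define k where "k = (LEAST k. f k = Suc l)"
      have fk: "f k = Suc l" and kle: "k \<le> i'"
        using i'(2) LeastI[of "\<lambda>k. f k = Suc l" i'] Least_le[of "\<lambda>k. f k = Suc l" i']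
        by (auto simp: k_def)
      have ik: "i < k"
        using monoD[OF mono, of k i] i(2) fk by (cases "i < k") auto
      then obtain j where j: "k = Suc j" by (cases k) auto
      have "f j \<noteq> Suc l"
        using not_less_Least[of j "\<lambda>k. f k = Suc l"] j by (simp add: k_def)
      moreover have "f j \<le> Suc l" "l \<le> f j"
        using monoD[OF mono, of j k] monoD[OF mono, of i j] ik j fk i(2) by auto
      ultimately have fj: "f j = l" by simp
      moreover have "j \<in> changes xs"
        using eq[of j] j kle i'(1) fj fk by (auto simp: changes_def)
      ultimately show "l \<in> f ` changes xs" by blast
    qed
  qed
  moreover have "ys ! f j = xs ! j \<and> ys ! Suc (f j) = xs ! Suc j" if "j \<in> changes xs" for j
    using that jump[OF that] nth[of j] nth[of "Suc j"] by (auto simp: changes_def)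
  ultimately show ?thesis
    unfolding ys_def bij_betw_def by blast
qed

lemma sorted_wrt_psubset_unique:
  fixes xs ys :: "'a set list"
  assumes "sorted_wrt (\<subset>) xs" "sorted_wrt (\<subset>) ys" "set xs = set ys"
  shows "xs = ys"
  using assms
proof (induction xs arbitrary: ys)
  case (Cons x xs)
  then obtain y ys' where ys: "ys = y # ys'" by (cases ys) auto
  have x: "x \<subset> z" if "z \<in> set xs" for z using Cons.prems(1) that by simp
  have y: "y \<subset> z" if "z \<in> set ys'" for z using Cons.prems(2) ys that by simp
  have "x \<in> insert y (set ys')" "y \<in> insert x (set xs)"
    using Cons.prems(3) ys by auto
  then have "x = y" using x y by blast
  moreover from this have "x \<notin> set xs" "x \<notin> set ys'"
    using x y by blast+
  then have "set xs = set ys'"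
    using Cons.prems(3) ys \<open>x = y\<close> by (simp add: insert_ident)
  ultimately show ?case
    using Cons ys by simp
qed simp


section \<open>The Schreier refinement theorem\<close>

text \<open>Between \<open>S\<^sub>i\<close> and \<open>S\<^sub>i\<^sub>+\<^sub>1\<close> the terms \<open>S\<^sub>i (S\<^sub>i\<^sub>+\<^sub>1 \<inter> T\<^sub>j)\<close> for \<open>j < m\<close> are inserted, where \<open>m\<close> is the number of
  factors of \<open>T\<close>. The index \<open>j = m\<close> is left out, as its term \<open>S\<^sub>i\<^sub>+\<^sub>1\<close> is also the first one of the next
  block; only the last block needs its end point \<open>G\<close>.\<close>

definition schreier_refinement ::
    "('a, 'b) monoid_scheme \<Rightarrow> 'a set list \<Rightarrow> 'a set list \<Rightarrow> 'a set list" where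
  "schreier_refinement G S T =
    map (\<lambda>k. let i = k div (length T - 1); j = k mod (length T - 1)
      in S ! i <#>\<^bsub>G\<^esub> (S ! Suc i \<inter> T ! j)) [0..<(length S - 1) * (length T - 1)] @ [carrier G]"

lemma series_isomorphic_refl: "series_isomorphic \<Omega> G S S"
  unfolding series_isomorphic_def
  by (rule exI[where x = id]) (auto simp: op_isomorphic_refl bij_betw_id)

context product_closed_op_group
begin

lemma op_series_nth:
  assumes "op_series \<Omega> G S"
  shows "S ! 0 = {\<one>}" "S ! (length S - 1) = carrier G" "length S > 0"
    "i < length S \<Longrightarrow> op_subgroup \<Omega> (S ! i) G"
    "Suc i < length S \<Longrightarrow> S ! i \<lhd> G\<lparr>carrier := S ! Suc i\<rparr>"
  using assms by (auto simp: op_series_def hd_conv_nth last_conv_nth)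

lemma op_series_Suc:
  assumes "op_series \<Omega> G S" "Suc i < length S"
  shows "S ! i \<subseteq> S ! Suc i"
  using normal_imp_subgroup[OF op_series_nth(5)[OF assms]] subgroup.subset by fastforce

lemma op_series_mono:
  assumes "op_series \<Omega> G S" "i \<le> j" "j < length S"
  shows "S ! i \<subseteq> S ! j"
  using assms(2,3)
proof (induction j rule: dec_induct)
  case (step j)
  then show ?case using op_series_Suc[OF assms(1), of j] by auto
qed simp

text \<open>At the end of a block the successor of the term \<open>(i, j)\<close> is formally \<open>(i + 1, 0)\<close>, but the formula with
  \<open>(i, j + 1)\<close> also holds, as \<open>S\<^sub>i (S\<^sub>i\<^sub>+\<^sub>1 \<inter> G) = S\<^sub>i\<^sub>+\<^sub>1 = S\<^sub>i\<^sub>+\<^sub>1 (S\<^sub>i\<^sub>+\<^sub>2 \<inter> 1)\<close>. So all factors have the shape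
  required by the Zassenhaus lemma.\<close>

lemma schreier_refinement_nth:
  assumes S: "op_series \<Omega> G S" and T: "op_series \<Omega> G T"
    and k: "k < (length S - 1) * (length T - 1)"
  defines "i \<equiv> k div (length T - 1)" and "j \<equiv> k mod (length T - 1)"
  shows "i < length S - 1" "j < length T - 1"
    "schreier_refinement G S T ! k = S ! i <#> (S ! Suc i \<inter> T ! j)"
    "schreier_refinement G S T ! Suc k = S ! i <#> (S ! Suc i \<inter> T ! Suc j)"
proof -
  let ?m = "length T - 1" and ?n = "length S - 1"
  have m: "?m > 0" using k by (cases "?m") auto
  show i: "i < ?n"
    using k by (simp add: i_def less_mult_imp_div_less)
  show j: "j < ?m"
    using m by (simp add: j_def)
  show "schreier_refinement G S T ! k = S ! i <#> (S ! Suc i \<inter> T ! j)"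
    using k by (simp add: schreier_refinement_def nth_append i_def j_def Let_def)
  have sub: "subgroup (S ! i) G" "subgroup (S ! Suc i) G" if "i < ?n" for i
    using op_series_nth(4)[OF S] that by (auto simp: op_subgroup_def)
  have full: "S ! i <#> (S ! Suc i \<inter> T ! ?m) = S ! Suc i"
  proof -
    have T': "S ! Suc i \<inter> T ! ?m = S ! Suc i"
      using subgroup.subset[OF sub(2)[OF i]] op_series_nth(2)[OF T] by auto
    have "x \<in> S ! i <#> S ! Suc i" if "x \<in> S ! Suc i" for x
    proof -
      have "x = \<one> \<otimes> x" using subgroup.mem_carrier[OF sub(2)[OF i] that] by simp
      then show ?thesis
        using that subgroup.one_closed[OF sub(1)[OF i]] unfolding set_mult_def by blast
    qed
    moreover have "S ! i \<subseteq> S ! Suc i"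
      using op_series_Suc[OF S] i by simp
    then have "S ! i <#> S ! Suc i \<subseteq> S ! Suc i"
      using subgroup.m_closed[OF sub(2)[OF i]] by (auto simp: set_mult_def)
    ultimately show ?thesis
      unfolding T' by blast
  qed
  have start: "S ! i <#> (S ! Suc i \<inter> T ! 0) = S ! i" if "i < ?n" for i
  proof -
    have "S ! Suc i \<inter> T ! 0 = {\<one>}"
      using op_series_nth(1)[OF T] subgroup.one_closed[OF sub(2)[OF that]] by auto
    then show ?thesis
      using subgroup.mem_carrier[OF sub(1)[OF that]] by (auto simp: set_mult_def)
  qed
  show "schreier_refinement G S T ! Suc k = S ! i <#> (S ! Suc i \<inter> T ! Suc j)"
  proof (cases "Suc j = ?m")
    case False
    then have "Suc j < ?m" using j by simp
    then have dm: "Suc k div ?m = i" "Suc k mod ?m = Suc j"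
      by (auto simp: i_def j_def div_Suc mod_Suc)
    moreover have "Suc k < ?n * ?m"
    proof -
      have "Suc k = i * ?m + Suc j"
        using dm by (metis div_mult_mod_eq)
      also have "\<dots> < Suc i * ?m" using \<open>Suc j < ?m\<close> by simp
      also have "\<dots> \<le> ?n * ?m" using i by (intro mult_right_mono) auto
      finally show ?thesis .
    qed
    ultimately show ?thesis
      by (simp add: schreier_refinement_def nth_append Let_def)
  next
    case True
    then have dm: "Suc k div ?m = Suc i" "Suc k mod ?m = 0"
      by (auto simp: i_def j_def div_Suc mod_Suc)
    then have Sk: "Suc k = Suc i * ?m"
      by (metis add.right_neutral div_mult_mod_eq)
    show ?thesis
    proof (cases "Suc i = ?n")
      case True
      then have "schreier_refinement G S T ! Suc k = carrier G"
        unfolding Sk by (simp add: schreier_refinement_def nth_append)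
      then show ?thesis
        using full \<open>Suc j = ?m\<close> True op_series_nth(2)[OF S] by simp
    next
      case False
      then have i': "Suc i < ?n" using i by simp
      then have "Suc k < ?n * ?m"
        unfolding Sk using m by (intro mult_strict_right_mono)
      then have "schreier_refinement G S T ! Suc k = S ! Suc i <#> (S ! Suc (Suc i) \<inter> T ! 0)"
        using dm by (simp add: schreier_refinement_def nth_append Let_def)
      then show ?thesis
        using full \<open>Suc j = ?m\<close> start[OF i'] by simp
    qed
  qed
qed

lemma length_schreier_refinement [simp]:
  "length (schreier_refinement G S T) = Suc ((length S - 1) * (length T - 1))"
  by (simp add: schreier_refinement_def)

lemma refinement_schreier:
  assumes S: "op_series \<Omega> G S" and T: "op_series \<Omega> G T"
    and len: "length S > 1" "length T > 1"
  shows "refinement \<Omega> G S (schreier_refinement G S T)"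
proof -
  let ?m = "length T - 1" and ?n = "length S - 1" and ?R = "schreier_refinement G S T"
  note nth = schreier_refinement_nth[OF S T]
  have nm: "0 < ?n * ?m" using len by simp
  have at_mult: "?R ! (i * ?m) = S ! i" if i: "i < ?n" for i
  proof -
    have "i * ?m < ?n * ?m"
      using i len by simp
    then have "?R ! (i * ?m) = S ! i <#> (S ! Suc i \<inter> T ! 0)"
      using nth(3)[of "i * ?m"] len by simp
    moreover have sub: "subgroup (S ! i) G" "subgroup (S ! Suc i) G"
      using op_series_nth(4)[OF S] i by (auto simp: op_subgroup_def)
    have "S ! Suc i \<inter> T ! 0 = {\<one>}"
      using op_series_nth(1)[OF T] subgroup.one_closed[OF sub(2)] by auto
    ultimately show ?thesis
      using subgroup.mem_carrier[OF sub(1)] by (auto simp: set_mult_def)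
  qed
  have last: "?R ! (?n * ?m) = carrier G"
    by (simp add: schreier_refinement_def nth_append)
  have "op_subgroup \<Omega> (?R ! k) G" if "k \<le> ?n * ?m" for k
  proof (cases "k = ?n * ?m")
    case True
    then show ?thesis using last op_subgroup_carrier by simp
  next
    case False
    then have k: "k < ?n * ?m" using that by simp
    define i j where "i = k div ?m" and "j = k mod ?m"
    have "i < ?n" "j < ?m" "?R ! k = S ! i <#> (S ! Suc i \<inter> T ! j)"
      using nth(1-3)[OF k] by (auto simp: i_def j_def)
    moreover have "op_subgroup \<Omega> (S ! i <#> (S ! Suc i \<inter> T ! j)) G"
      using \<open>i < ?n\<close> \<open>j < ?m\<close>
      by (intro op_subgroup_Zassenhaus op_series_nth[OF S] op_series_nth(4)[OF T]) auto
    ultimately show ?thesis by simp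
  qed
  then have ops: "op_subgroup \<Omega> H G" if "H \<in> set ?R" for H
    using that by (auto simp: in_set_conv_nth)
  have normal: "?R ! k \<lhd> G\<lparr>carrier := ?R ! Suc k\<rparr>" if "Suc k < length ?R" for k
  proof -
    have k: "k < ?n * ?m" using that by simp
    define i j where "i = k div ?m" and "j = k mod ?m"
    have ij: "i < ?n" "j < ?m" "?R ! k = S ! i <#> (S ! Suc i \<inter> T ! j)"
        "?R ! Suc k = S ! i <#> (S ! Suc i \<inter> T ! Suc j)"
      using nth(1-4)[OF k] by (auto simp: i_def j_def)
    have "subgroup (S ! Suc i) G" "subgroup (T ! Suc j) G"
      using op_series_nth(4)[OF S, of "Suc i"] op_series_nth(4)[OF T, of "Suc j"] ij
      by (auto simp: op_subgroup_def)
    then show ?thesis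
      unfolding ij(3,4)
      using preliminary2 op_series_nth(5)[OF S, of i] op_series_nth(5)[OF T, of j] ij by auto
  qed
  have "?R \<noteq> []" "last ?R = carrier G"
    by (auto simp: schreier_refinement_def)
  moreover have "hd ?R = {\<one>}"
    using at_mult[of 0] len op_series_nth(1)[OF S] \<open>?R \<noteq> []\<close> by (simp add: hd_conv_nth)
  ultimately have "op_series \<Omega> G ?R"
    using ops normal by (simp add: op_series_def)
  moreover have "set S \<subseteq> set ?R"
  proof
    fix H assume "H \<in> set S"
    then obtain i where i: "i < length S" "H = S ! i" by (auto simp: in_set_conv_nth)
    show "H \<in> set ?R"
    proof (cases "i = ?n")
      case True
      then show ?thesis
        using i last op_series_nth(2)[OF S] nth_mem[of "?n * ?m" ?R] by simp
    next
      case False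
      then have "i < ?n" using i by simp
      then have "i * ?m < length ?R"
        by (simp add: less_Suc_eq_le)
      then show ?thesis
        using at_mult[OF \<open>i < ?n\<close>] i nth_mem by metis
    qed
  qed
  ultimately show ?thesis
    by (simp add: refinement_def)
qed

text \<open>The Zassenhaus lemma matches the factor \<open>(i, j)\<close> of the first refinement with the factor \<open>(j, i)\<close> of the
  second one; in terms of list indices this is the transposition of a rectangular grid.\<close>

lemma series_isomorphic_schreier:
  assumes S: "op_series \<Omega> G S" and T: "op_series \<Omega> G T"
  shows "series_isomorphic \<Omega> G (schreier_refinement G S T) (schreier_refinement G T S)"
proof -
  let ?m = "length T - 1" and ?n = "length S - 1"
  define \<pi> where "\<pi> = (\<lambda>k. (k mod ?m) * ?n + k div ?m)"
  define \<rho> where "\<rho> = (\<lambda>k. (k mod ?n) * ?m + k div ?n)"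
  have swap: "(k mod m) * n + k div m < m * n"
      "((k mod m) * n + k div m) div n = k mod m" "((k mod m) * n + k div m) mod n = k div m"
    if k: "k < n * m" for k m n :: nat
  proof -
    have "m > 0" using k by (cases m) auto
    then have a: "k div m < n" "k mod m < m"
      using k by (auto simp: less_mult_imp_div_less)
    then show "((k mod m) * n + k div m) div n = k mod m" "((k mod m) * n + k div m) mod n = k div m"
      by auto
    have "(k mod m) * n + k div m < Suc (k mod m) * n" using a by simp
    also have "\<dots> \<le> m * n" using a by (intro mult_right_mono) auto
    finally show "(k mod m) * n + k div m < m * n" .
  qed
  have inv: "(((k mod m) * n + k div m) mod n) * m + ((k mod m) * n + k div m) div n = k"
    if "k < n * m" for k m n :: nat
    unfolding swap(2,3)[OF that] by simp
  have "bij_betw \<pi> {..<?n * ?m} {..<?m * ?n}"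
    by (rule bij_betw_byWitness[where f' = \<rho>])
      (use inv[of _ ?n ?m] inv[of _ ?m ?n] swap(1)[of _ ?n ?m] swap(1)[of _ ?m ?n]
        in \<open>auto simp: \<pi>_def \<rho>_def\<close>)
  moreover have "op_isomorphic \<Omega> (series_factor G (schreier_refinement G S T) k)
      (series_factor G (schreier_refinement G T S) (\<pi> k))" if k: "k < ?n * ?m" for k
  proof -
    define i j where "i = k div ?m" and "j = k mod ?m"
    have \<pi>: "\<pi> k < ?m * ?n" "\<pi> k div ?n = j" "\<pi> k mod ?n = i"
      using swap[OF k] by (auto simp: \<pi>_def i_def j_def)
    note a = schreier_refinement_nth[OF S T k, folded i_def j_def]
    note b = schreier_refinement_nth[OF T S \<pi>(1), unfolded \<pi>(2,3)]
    have i: "i < length S" "Suc i < length S" and j: "j < length T" "Suc j < length T"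
      using a(1,2) by auto
    show ?thesis
      unfolding series_factor_def a(3,4) b(3,4)
      by (rule Zassenhaus_op; intro op_series_nth[OF S] op_series_nth[OF T] i j)
  qed
  ultimately show ?thesis
    unfolding series_isomorphic_def by auto
qed

theorem Schreier_refinement_theorem:
  assumes S: "op_series \<Omega> G S" and T: "op_series \<Omega> G T"
  shows "\<exists>S' T'. refinement \<Omega> G S S' \<and> refinement \<Omega> G T T' \<and> series_isomorphic \<Omega> G S' T'"
proof (cases "length S > 1 \<and> length T > 1")
  case True
  then show ?thesis
    using refinement_schreier[OF S T] refinement_schreier[OF T S]
      series_isomorphic_schreier[OF S T] by blast
next
  \<comment> \<open>A series without factors exists only in the trivial group, where all series have the same set of terms.\<close>
  case False
  have triv: "carrier G = {\<one>}" if X: "op_series \<Omega> G X" "\<not> length X > 1" for X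
  proof -
    have "length X - 1 = 0" using X(2) by simp
    then show ?thesis using op_series_nth(1,2)[OF X(1)] by simp
  qed
  have carrier: "carrier G = {\<one>}"
    using False triv S T by blast
  have "set X = {{\<one>}}" if X: "op_series \<Omega> G X" for X
  proof -
    have "H = {\<one>}" if "H \<in> set X" for H
    proof -
      have "subgroup H G" using X that by (auto simp: op_series_def op_subgroup_def)
      then show ?thesis
        using subgroup.subset[of H G] subgroup.one_closed[of H G] carrier by auto
    qed
    moreover have "X \<noteq> []" using X by (simp add: op_series_def)
    ultimately show ?thesis by (cases X) auto
  qed
  then have "set S = set T" using S T by simp
  then have "refinement \<Omega> G S S" "refinement \<Omega> G T S"
    using S by (simp_all add: refinement_def)
  then show ?thesis
    using series_isomorphic_refl by blast
qed

end


section \<open>The Jordan-Hoelder theorem\<close>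

context product_closed_op_group
begin

lemma carrier_factor_trivial_iff:
  assumes "op_subgroup \<Omega> A G" "op_subgroup \<Omega> N G" "N \<subseteq> A"
  shows "is_singleton (carrier (factor G A N)) \<longleftrightarrow> N = A"
proof -
  have sub: "subgroup A G" "subgroup N G"
    using assms by (auto simp: op_subgroup_def)
  have N_rcos: "N = N #> \<one>"
    using subgroup.subset[OF sub(2)] by simp
  then have N: "N \<in> carrier (factor G A N)"
    unfolding carrier_factor using subgroup.one_closed[OF sub(1)] by blast
  show ?thesis
  proof
    assume "is_singleton (carrier (factor G A N))"
    then have single: "C = N" if "C \<in> carrier (factor G A N)" for C
      using N that by (metis is_singleton_the_elem singletonD)
    have "a \<in> N" if "a \<in> A" for a
      using rcos_self[OF subgroup.mem_carrier[OF sub(1) that] sub(2)] single[of "N #> a"] that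
      by (auto simp: carrier_factor)
    then show "N = A" using assms(3) by blast
  next
    assume "N = A"
    have "N #> x = N" if "x \<in> A" for x
      using that \<open>N = A\<close> coset_join2[OF subgroup.mem_carrier[OF sub(1) that] sub(2)] by simp
    then have "carrier (factor G A N) = {N}"
      using N by (auto simp: carrier_factor)
    then show "is_singleton (carrier (factor G A N))" by simp
  qed
qed

lemma series_factor_trivial_iff:
  assumes S: "op_series \<Omega> G S" and j: "Suc j < length S"
  shows "is_singleton (carrier (series_factor G S j)) \<longleftrightarrow> S ! j = S ! Suc j"
  unfolding series_factor_def
  by (rule carrier_factor_trivial_iff)
    (use j in \<open>simp_all add: op_series_nth(4)[OF S] op_series_Suc[OF S]\<close>)

text \<open>An isomorphism of factors detects repetitions of terms, because a factor is trivial exactly at a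
  repetition.\<close>

lemma op_isomorphic_trivial_factor_iff:
  assumes S: "op_series \<Omega> G S" and T: "op_series \<Omega> G T"
    and j: "Suc j < length S" and k: "Suc k < length T"
    and iso: "op_isomorphic \<Omega> (series_factor G S j) (series_factor G T k)"
  shows "S ! j = S ! Suc j \<longleftrightarrow> T ! k = T ! Suc k"
proof -
  obtain f where "bij_betw f (carrier (series_factor G S j)) (carrier (series_factor G T k))"
    using iso by (auto simp: op_isomorphic_def iso_def)
  then have "is_singleton (carrier (series_factor G S j)) \<longleftrightarrow>
      is_singleton (carrier (series_factor G T k))"
    by (metis bij_betw_same_card is_singleton_altdef)
  then show ?thesis
    using series_factor_trivial_iff[OF S j] series_factor_trivial_iff[OF T k] by simp
qed

lemma op_series_remdups_adj:
  assumes S: "op_series \<Omega> G S"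
  shows "op_series \<Omega> G (remdups_adj S)"
proof -
  obtain f where f: "bij_betw f {j. Suc j < length S \<and> S ! j \<noteq> S ! Suc j}
        {..<length (remdups_adj S) - 1}"
    and eq: "\<And>j. \<lbrakk>Suc j < length S; S ! j \<noteq> S ! Suc j\<rbrakk> \<Longrightarrow>
        remdups_adj S ! f j = S ! j \<and> remdups_adj S ! Suc (f j) = S ! Suc j"
    using bij_betw_changes_remdups_adj[of S] by auto
  have "remdups_adj S ! l \<lhd> G\<lparr>carrier := remdups_adj S ! Suc l\<rparr>"
    if l: "Suc l < length (remdups_adj S)" for l
  proof -
    have "l \<in> f ` {j. Suc j < length S \<and> S ! j \<noteq> S ! Suc j}"
      using f l by (auto simp: bij_betw_def)
    then obtain j where j: "Suc j < length S" "S ! j \<noteq> S ! Suc j" "l = f j" by auto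
    then show ?thesis
      using eq[OF j(1,2)] op_series_nth(5)[OF S j(1)] by simp
  qed
  then show ?thesis
    using S by (simp add: op_series_def)
qed

lemma sorted_wrt_op_series:
  assumes S: "op_series \<Omega> G S" and "\<And>j. Suc j < length S \<Longrightarrow> S ! j \<noteq> S ! Suc j"
  shows "sorted_wrt (\<subset>) S"
  unfolding sorted_wrt_iff_nth_less
proof (intro allI impI)
  fix i j assume ij: "i < j" "j < length S"
  then have "S ! i \<subset> S ! Suc i"
    using op_series_Suc[OF S, of i] assms(2)[of i] by auto
  then show "S ! i \<subset> S ! j"
    using op_series_mono[OF S, of "Suc i" j] ij by auto
qed

lemma sorted_wrt_remdups_adj:
  "op_series \<Omega> G S \<Longrightarrow> sorted_wrt (\<subset>) (remdups_adj S)"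
  by (rule sorted_wrt_op_series[OF op_series_remdups_adj])
    (simp_all add: remdups_adj_adjacent)

lemma distinct_remdups_adj_op_series:
  assumes "op_series \<Omega> G S"
  shows "distinct (remdups_adj S)"
proof -
  have "distinct xs" if "sorted_wrt (\<subset>) xs" for xs :: "'a set list"
    using that by (induction xs) auto
  then show ?thesis
    using sorted_wrt_remdups_adj[OF assms] .
qed

lemma remdups_adj_eq_of_set_eq:
  assumes S: "op_series \<Omega> G S" "distinct S" and R: "op_series \<Omega> G R" "set R = set S"
  shows "remdups_adj R = S"
proof (rule sorted_wrt_psubset_unique)
  show "sorted_wrt (\<subset>) (remdups_adj R)"
    using R by (simp add: sorted_wrt_remdups_adj)
  show "sorted_wrt (\<subset>) S"
    using sorted_wrt_remdups_adj[OF S(1)] S(2) by (simp add: remdups_adj_distinct)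
  show "set (remdups_adj R) = set S"
    using R by simp
qed

text \<open>A bijection between all factors restricts to the non-trivial ones, and these are the factors that
  remain when repetitions are deleted.\<close>

lemma series_isomorphic_remdups_adj:
  assumes S: "op_series \<Omega> G S" and T: "op_series \<Omega> G T" and iso: "series_isomorphic \<Omega> G S T"
  shows "series_isomorphic \<Omega> G (remdups_adj S) (remdups_adj T)"
proof -
  define I where "I = (\<lambda>X :: 'a set list. {j. Suc j < length X \<and> X ! j \<noteq> X ! Suc j})"
  have ex: "\<exists>f. bij_betw f (I X) {..<length (remdups_adj X) - 1} \<and>
      (\<forall>j\<in>I X. series_factor G (remdups_adj X) (f j) = series_factor G X j)" for X
  proof -
    obtain f where "bij_betw f (I X) {..<length (remdups_adj X) - 1}"
        "\<forall>j\<in>I X. remdups_adj X ! f j = X ! j \<and> remdups_adj X ! Suc (f j) = X ! Suc j"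
      using bij_betw_changes_remdups_adj[of X] unfolding I_def by blast
    then show ?thesis
      unfolding series_factor_def by (intro exI[where x = f]) simp
  qed
  obtain f where f: "bij_betw f (I S) {..<length (remdups_adj S) - 1}"
      "\<And>j. j \<in> I S \<Longrightarrow> series_factor G (remdups_adj S) (f j) = series_factor G S j"
    using ex[of S] by blast
  obtain g where g: "bij_betw g (I T) {..<length (remdups_adj T) - 1}"
      "\<And>j. j \<in> I T \<Longrightarrow> series_factor G (remdups_adj T) (g j) = series_factor G T j"
    using ex[of T] by blast
  obtain \<pi> where \<pi>: "bij_betw \<pi> {..<length S - 1} {..<length T - 1}"
      "\<And>j. j < length S - 1 \<Longrightarrow> op_isomorphic \<Omega> (series_factor G S j) (series_factor G T (\<pi> j))"
    using iso by (auto simp: series_isomorphic_def)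
  have \<pi>_less: "\<pi> j < length T - 1" if "j < length S - 1" for j
    using \<pi>(1) that by (auto simp: bij_betw_def)
  have triv: "S ! j = S ! Suc j \<longleftrightarrow> T ! \<pi> j = T ! Suc (\<pi> j)" if "j < length S - 1" for j
    using op_isomorphic_trivial_factor_iff[OF S T _ _ \<pi>(2)[OF that]] that \<pi>_less[OF that] by simp
  have "\<pi> ` I S = I T"
  proof
    show "\<pi> ` I S \<subseteq> I T"
    proof
      fix k assume "k \<in> \<pi> ` I S"
      then obtain j where j: "j \<in> I S" "k = \<pi> j" by blast
      then have "j < length S - 1" by (auto simp: I_def)
      then have "\<pi> j < length T - 1" "T ! \<pi> j \<noteq> T ! Suc (\<pi> j)"
        using triv[of j] \<pi>_less[of j] j(1) by (auto simp: I_def)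
      then show "k \<in> I T"
        unfolding I_def j(2) by simp
    qed
    show "I T \<subseteq> \<pi> ` I S"
    proof
      fix k assume k: "k \<in> I T"
      then have "k \<in> \<pi> ` {..<length S - 1}"
        using \<pi>(1) by (auto simp: I_def bij_betw_def)
      then obtain j where j: "j < length S - 1" "k = \<pi> j" by auto
      then have "j \<in> I S"
        using k triv[OF j(1)] by (auto simp: I_def)
      then show "k \<in> \<pi> ` I S" using j by blast
    qed
  qed
  moreover have "I S \<subseteq> {..<length S - 1}"
    by (auto simp: I_def)
  ultimately have \<pi>I: "bij_betw \<pi> (I S) (I T)"
    by (intro bij_betw_subset[OF \<pi>(1)])
  define h where "h = inv_into (I S) f"
  have h: "bij_betw h {..<length (remdups_adj S) - 1} (I S)"
    unfolding h_def by (rule bij_betw_inv_into[OF f(1)])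
  have "bij_betw (g \<circ> (\<pi> \<circ> h)) {..<length (remdups_adj S) - 1} {..<length (remdups_adj T) - 1}"
    by (intro bij_betw_trans[OF bij_betw_trans[OF h \<pi>I] g(1)])
  moreover have "op_isomorphic \<Omega> (series_factor G (remdups_adj S) l)
      (series_factor G (remdups_adj T) ((g \<circ> (\<pi> \<circ> h)) l))" if l: "l < length (remdups_adj S) - 1" for l
  proof -
    have "h l \<in> I S" "\<pi> (h l) \<in> I T"
      using h \<pi>I l by (auto simp: bij_betw_def)
    moreover have "f (h l) = l"
      using f(1) l unfolding h_def by (intro bij_betw_inv_into_right) auto
    moreover have "h l < length S - 1"
      using \<open>h l \<in> I S\<close> by (auto simp: I_def)
    ultimately show ?thesis
      using f(2)[of "h l"] g(2)[of "\<pi> (h l)"] \<pi>(2)[of "h l"] by simp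
  qed
  ultimately show ?thesis
    unfolding series_isomorphic_def by blast
qed

lemma series_isomorphic_length:
  assumes "series_isomorphic \<Omega> G S T" "op_series \<Omega> G S" "op_series \<Omega> G T"
  shows "length S = length T"
proof -
  have "length S - 1 = length T - 1"
    using assms(1) bij_betw_same_card unfolding series_isomorphic_def by fastforce
  then show ?thesis
    using op_series_nth(3)[OF assms(2)] op_series_nth(3)[OF assms(3)] by linarith
qed

lemma card_set_op_series: "op_series \<Omega> G S \<Longrightarrow> card (set S) = length (remdups_adj S)"
  using distinct_card[OF distinct_remdups_adj_op_series] by simp

text \<open>A refinement of a composition series has no additional terms, so only its repetitions can differ.\<close>

lemma composition_series_refinement:
  assumes S: "composition_series \<Omega> G S" and R: "refinement \<Omega> G S R"
  shows "remdups_adj R = S"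
proof (rule remdups_adj_eq_of_set_eq)
  show "set R = set S"
    using assms by (auto simp: composition_series_def proper_refinement_def refinement_def)
qed (use assms in \<open>auto simp: composition_series_def refinement_def\<close>)

theorem composition_series_isomorphic:
  assumes "composition_series \<Omega> G S" "composition_series \<Omega> G T"
  shows "series_isomorphic \<Omega> G S T"
proof -
  obtain S' T' where *: "refinement \<Omega> G S S'" "refinement \<Omega> G T T'" "series_isomorphic \<Omega> G S' T'"
    using Schreier_refinement_theorem assms unfolding composition_series_def by blast
  then have "series_isomorphic \<Omega> G (remdups_adj S') (remdups_adj T')"
    by (intro series_isomorphic_remdups_adj) (auto simp: refinement_def)
  then show ?thesis
    using * assms by (simp add: composition_series_refinement)
qed

text \<open>Every series has a refinement which becomes isomorphic to \<open>S\<close> after deletion of repetitions, and thus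
  has as many distinct terms as \<open>S\<close>. Applied to \<open>T\<close> this produces the desired \<open>R\<close>; applied to a proper
  refinement of \<open>R\<close> it shows that there is none, as that one would have more distinct terms than \<open>S\<close>.\<close>

theorem Jordan_Hoelder_theorem:
  assumes S: "composition_series \<Omega> G S" and T: "op_series \<Omega> G T"
  shows "\<exists>R. refinement \<Omega> G T R \<and> composition_series \<Omega> G R \<and> series_isomorphic \<Omega> G R S"
proof -
  have S': "op_series \<Omega> G S" using S by (simp add: composition_series_def)
  \<comment> \<open>Deleting repetitions in a refinement that the Schreier theorem matches with one of \<open>S\<close>\<close>
  have key: "\<exists>R. refinement \<Omega> G X R \<and> series_isomorphic \<Omega> G (remdups_adj R) S"
    if X: "op_series \<Omega> G X" for X
  proof -
    obtain R S1 where *: "refinement \<Omega> G X R" "refinement \<Omega> G S S1" "series_isomorphic \<Omega> G R S1"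
      using Schreier_refinement_theorem[OF X S'] by blast
    then have "series_isomorphic \<Omega> G (remdups_adj R) (remdups_adj S1)"
      by (intro series_isomorphic_remdups_adj) (auto simp: refinement_def)
    then show ?thesis
      using * composition_series_refinement[OF S] by auto
  qed
  obtain T' where T': "refinement \<Omega> G T T'" "series_isomorphic \<Omega> G (remdups_adj T') S"
    using key[OF T] by blast
  let ?R = "remdups_adj T'"
  have R: "op_series \<Omega> G ?R" "distinct ?R"
    using T' by (auto simp: refinement_def op_series_remdups_adj distinct_remdups_adj_op_series)
  have len: "length (remdups_adj Q) = length S"
    if "series_isomorphic \<Omega> G (remdups_adj Q) S" "op_series \<Omega> G Q" for Q
    using series_isomorphic_length[OF that(1) op_series_remdups_adj[OF that(2)] S'] .
  have "\<not> proper_refinement \<Omega> G ?R Q" for Q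
  proof
    assume Q: "proper_refinement \<Omega> G ?R Q"
    then have Q': "op_series \<Omega> G Q" "set ?R \<subset> set Q"
      by (auto simp: proper_refinement_def refinement_def)
    obtain P where P: "refinement \<Omega> G Q P" "series_isomorphic \<Omega> G (remdups_adj P) S"
      using key[OF Q'(1)] by blast
    have P': "op_series \<Omega> G P" "set Q \<subseteq> set P" using P by (auto simp: refinement_def)
    have "length S = card (set ?R)"
      using len[OF T'(2)] T'(1) R card_set_op_series[of T'] by (simp add: refinement_def)
    also have "\<dots> < card (set Q)"
      using Q'(2) by (simp add: psubset_card_mono)
    also have "\<dots> \<le> card (set P)"
      using P'(2) by (simp add: card_mono)
    also have "\<dots> = length S"
      using len[OF P(2) P'(1)] card_set_op_series[OF P'(1)] by simp
    finally show False by simp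
  qed
  then have "composition_series \<Omega> G ?R"
    using R by (simp add: composition_series_def)
  moreover have "refinement \<Omega> G T ?R"
    using R T'(1) by (simp add: refinement_def)
  ultimately show ?thesis
    using T'(2) by blast
qed

text \<open>A series with the largest number of distinct terms cannot be refined properly.\<close>

theorem composition_series_exists:
  assumes bound: "\<And>S. op_series \<Omega> G S \<Longrightarrow> card (set S) \<le> n"
  shows "\<exists>S. composition_series \<Omega> G S"
proof -
  have "{\<one>} \<lhd> G"
    using one_is_normal .
  then have "op_series \<Omega> G [{\<one>}, carrier G]"
    using op_subgroup_one op_subgroup_carrier by (simp add: op_series_def)
  then obtain S where S: "op_series \<Omega> G S"
    and max: "\<And>R. op_series \<Omega> G R \<Longrightarrow> card (set R) \<le> card (set S)"
    using ex_has_greatest_nat[of "op_series \<Omega> G" _ "\<lambda>S. card (set S)" "Suc n"] bound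
    by (metis less_Suc_eq_le)
  have "\<not> proper_refinement \<Omega> G (remdups_adj S) R" for R
  proof
    assume "proper_refinement \<Omega> G (remdups_adj S) R"
    then have "op_series \<Omega> G R" "set S \<subset> set R"
      by (auto simp: proper_refinement_def refinement_def)
    then show False
      using max[of R] psubset_card_mono[of "set R" "set S"] by simp
  qed
  then show ?thesis
    using op_series_remdups_adj[OF S] distinct_remdups_adj_op_series[OF S]
    by (auto simp: composition_series_def)
qed

end


section \<open>Compact open subgroups\<close>

text \<open>In a compact Hausdorff space components agree with quasi-components. Hence in a compact neighbourhood
  \<open>K\<close> of \<open>x\<close> a subset that is open and closed in \<open>K\<close> separates \<open>x\<close> from the complement in \<open>K\<close> of an open set
  \<open>W \<subseteq> K\<close>; as it lies in \<open>W\<close>, it is open in the whole space.\<close>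

lemma compact_open_neighbourhood:
  assumes td: "totally_disconnected_space X" and lc: "locally_compact_space X"
    and hd: "Hausdorff_space X" and V: "openin X V" "x \<in> V"
  obtains C where "openin X C" "compactin X C" "x \<in> C" "C \<subseteq> V"
proof -
  obtain W K where W: "openin X W" and K: "compactin X K" and WK: "x \<in> W" "W \<subseteq> K" "K \<subseteq> V"
    using lc hd V locally_compact_space_neighbourhood_base[of X] neighbourhood_base_of[of "compactin X" X]
    by blast
  let ?Y = "subtopology X K"
  have KX: "K \<subseteq> topspace X" using K compactin_subset_topspace by blast
  then have topY: "topspace ?Y = K" by auto
  have "separated_between ?Y {x} (K - W)"
  proof (rule cut_wire_fence_theorem_gen)
    show "compact_space ?Y"
      using K by (simp add: compact_space_subtopology)
    show "Hausdorff_space ?Y \<or> regular_space ?Y \<or> normal_space ?Y"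
      using hd by (simp add: Hausdorff_space_subtopology)
    show "compactin ?Y {x}"
      using WK topY by (auto simp: compactin_sing)
    have "openin ?Y (K \<inter> W)"
      using W by (simp add: openin_subtopology_Int2)
    moreover have "K - (K - W) = K \<inter> W" by blast
    ultimately show "closedin ?Y (K - W)"
      unfolding closedin_def topY by (simp add: Diff_subset)
    fix C assume "connectedin ?Y C"
    then obtain a where "C \<subseteq> {a}"
      using td unfolding totally_disconnected_space_def connectedin_subtopology by blast
    then show "disjnt C {x} \<or> disjnt C (K - W)"
      using WK by (cases "a = x") (auto simp: disjnt_def)
  qed
  then obtain U where U: "closedin ?Y U" "openin ?Y U" "{x} \<subseteq> U" "K - W \<subseteq> K - U"
    unfolding separated_between topY by blast
  moreover have "U \<subseteq> K"
    using openin_subset[OF U(2)] topY by simp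
  ultimately have UW: "x \<in> U" "U \<subseteq> K \<inter> W" by auto
  obtain T where T: "openin X T" "U = T \<inter> K"
    using U(2) by (auto simp: openin_subtopology)
  have "U = T \<inter> W"
    using T UW WK(2) by blast
  then have "openin X U"
    using T W by (simp add: openin_Int)
  moreover have "compactin X U"
    using closedin_compact_space[of ?Y U] U(1) K
    by (simp add: compact_space_subtopology compactin_subtopology)
  ultimately show thesis
    using that UW WK by blast
qed

context topological_group
begin

lemma continuous_map_mult:
  assumes "continuous_map X (topol G) f" "continuous_map X (topol G) g"
  shows "continuous_map X (topol G) (\<lambda>x. f x \<otimes> g x)"
  using continuous_map_compose[OF continuous_map_pairedI[OF assms] continuous_mult]
  by (simp add: o_def)

lemma continuous_map_lmult: "a \<in> carrier G \<Longrightarrow> continuous_map (topol G) (topol G) (\<lambda>x. a \<otimes> x)"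
  by (intro continuous_map_mult) (simp_all add: topspace_topol)

lemma continuous_map_rmult: "a \<in> carrier G \<Longrightarrow> continuous_map (topol G) (topol G) (\<lambda>x. x \<otimes> a)"
  by (intro continuous_map_mult) (simp_all add: topspace_topol)

lemma openin_vimage:
  "continuous_map (topol G) (topol G) f \<Longrightarrow> openin (topol G) U \<Longrightarrow> openin (topol G) {x \<in> carrier G. f x \<in> U}"
  using openin_continuous_map_preimage[of "topol G" "topol G" f U] by (simp add: topspace_topol)

lemma closedin_vimage:
  "continuous_map (topol G) (topol G) f \<Longrightarrow> closedin (topol G) U \<Longrightarrow> closedin (topol G) {x \<in> carrier G. f x \<in> U}"
  using closedin_continuous_map_preimage[of "topol G" "topol G" f U] by (simp add: topspace_topol)

lemma openin_r_coset:
  assumes U: "openin (topol G) U" and a: "a \<in> carrier G"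
  shows "openin (topol G) (U #> a)"
proof -
  have sub: "U \<subseteq> carrier G" using openin_subset[OF U] by (simp add: topspace_topol)
  have "U #> a = {x \<in> carrier G. x \<otimes> inv a \<in> U}"
  proof
    show "U #> a \<subseteq> {x \<in> carrier G. x \<otimes> inv a \<in> U}"
      using sub a by (auto simp: r_coset_def m_assoc)
    show "{x \<in> carrier G. x \<otimes> inv a \<in> U} \<subseteq> U #> a"
    proof
      fix x assume x: "x \<in> {x \<in> carrier G. x \<otimes> inv a \<in> U}"
      then have "x = (x \<otimes> inv a) \<otimes> a" using a by (simp add: m_assoc)
      then show "x \<in> U #> a" using x unfolding r_coset_def by blast
    qed
  qed
  then show ?thesis
    using openin_vimage[OF continuous_map_rmult[of "inv a"] U] a by simp
qed

lemma openin_l_coset: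
  assumes U: "openin (topol G) U" and a: "a \<in> carrier G"
  shows "openin (topol G) (a <# U)"
proof -
  have sub: "U \<subseteq> carrier G" using openin_subset[OF U] by (simp add: topspace_topol)
  have "a <# U = {x \<in> carrier G. inv a \<otimes> x \<in> U}"
  proof
    show "a <# U \<subseteq> {x \<in> carrier G. inv a \<otimes> x \<in> U}"
      using sub a by (auto simp: l_coset_def simp flip: m_assoc)
    show "{x \<in> carrier G. inv a \<otimes> x \<in> U} \<subseteq> a <# U"
    proof
      fix x assume x: "x \<in> {x \<in> carrier G. inv a \<otimes> x \<in> U}"
      then have "x = a \<otimes> (inv a \<otimes> x)" using a by (simp flip: m_assoc)
      then show "x \<in> a <# U" using x unfolding l_coset_def by blast
    qed
  qed
  then show ?thesis
    using openin_vimage[OF continuous_map_lmult[of "inv a"] U] a by simp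
qed

lemma subgroup_openin_of_interior:
  assumes H: "subgroup H G" and U: "openin (topol G) U" "U \<noteq> {}" "U \<subseteq> H"
  shows "openin (topol G) H"
proof -
  obtain u where u: "u \<in> U" using U by blast
  have HG: "\<And>x. x \<in> H \<Longrightarrow> x \<in> carrier G" using subgroup.mem_carrier[OF H] .
  have uH: "u \<in> H" using u U by blast
  have "\<exists>T. openin (topol G) T \<and> x \<in> T \<and> T \<subseteq> H" if x: "x \<in> H" for x
  proof (intro exI conjI)
    let ?a = "inv u \<otimes> x"
    have a: "?a \<in> H" using x uH H by (simp add: subgroup.m_closed subgroup.m_inv_closed)
    show "openin (topol G) (U #> ?a)"
      using openin_r_coset[OF U(1)] HG[OF a] .
    have "x = u \<otimes> ?a" using HG[OF uH] HG[OF x] by (simp flip: m_assoc)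
    then show "x \<in> U #> ?a" using u unfolding r_coset_def by blast
    show "U #> ?a \<subseteq> H"
      using U(3) a subgroup.m_closed[OF H] by (auto simp: r_coset_def)
  qed
  then show ?thesis
    by (subst openin_subopen) blast
qed

text \<open>Van Dantzig's theorem. For a compact open neighbourhood \<open>C\<close> of \<open>1\<close> the left stabilizer of \<open>C\<close> is a
  subgroup contained in \<open>C\<close>. It is open because the set \<open>D\<close> of all \<open>x\<close> with \<open>x C \<subseteq> C\<close> is open: its
  complement is the projection along the compact set \<open>C\<close> of a closed set of pairs.\<close>

lemma compact_open_subgroup:
  assumes td: "totally_disconnected_space (topol G)" and lc: "locally_compact_space (topol G)"
    and V: "openin (topol G) V" "\<one> \<in> V"
  obtains U where "subgroup U G" "openin (topol G) U" "compactin (topol G) U" "U \<subseteq> V"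
proof -
  let ?X = "topol G"
  obtain C where C: "openin ?X C" "compactin ?X C" "\<one> \<in> C" "C \<subseteq> V"
    using compact_open_neighbourhood[OF td lc Hausdorff_topol V] .
  have CG: "C \<subseteq> carrier G" using openin_subset[OF C(1)] by (simp add: topspace_topol)
  have C_closed: "closedin ?X C"
    using C(2) Hausdorff_topol compactin_imp_closedin by blast
  define D where "D = {x \<in> carrier G. \<forall>c\<in>C. x \<otimes> c \<in> C}"
  have "D = (\<Inter>c\<in>C. {x \<in> carrier G. x \<otimes> c \<in> C})"
    using C(3) by (auto simp: D_def)
  moreover have "closedin ?X \<dots>"
    using C(3) CG C_closed by (intro closedin_INT closedin_vimage continuous_map_rmult) auto
  ultimately have D_closed: "closedin ?X D" by simp
  have D_open: "openin ?X D"
  proof -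
    let ?Y = "subtopology ?X C" and ?P = "prod_topology (topol G) (subtopology (topol G) C)"
    have topP: "topspace ?P = carrier G \<times> C"
      using CG by (auto simp: topspace_topol)
    have "continuous_map ?P ?X (\<lambda>p. fst p \<otimes> snd p)"
      by (intro continuous_map_mult continuous_map_fst
          continuous_map_into_fulltopology[OF continuous_map_snd])
    moreover have "closedin ?X (carrier G - C)"
      using C(1) by (simp add: closedin_diff topspace_topol flip: topspace_topol)
    ultimately have "closedin ?P {p \<in> topspace ?P. fst p \<otimes> snd p \<in> carrier G - C}"
      by (rule closedin_continuous_map_preimage)
    moreover have "closed_map ?P ?X fst"
      using C(2) by (intro closed_map_fst) (simp add: compact_space_subtopology)
    ultimately have "closedin ?X (fst ` {p \<in> topspace ?P. fst p \<otimes> snd p \<in> carrier G - C})"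
      by (auto simp: closed_map_def)
    moreover have "fst ` {p \<in> topspace ?P. fst p \<otimes> snd p \<in> carrier G - C} = carrier G - D"
    proof (intro equalityI subsetI)
      fix x assume "x \<in> fst ` {p \<in> topspace ?P. fst p \<otimes> snd p \<in> carrier G - C}"
      then obtain c where "x \<in> carrier G" "c \<in> C" "x \<otimes> c \<notin> C"
        unfolding topP by auto
      then show "x \<in> carrier G - D" by (auto simp: D_def)
    next
      fix x assume "x \<in> carrier G - D"
      then obtain c where c: "x \<in> carrier G" "c \<in> C" "x \<otimes> c \<notin> C"
        by (auto simp: D_def)
      then have "(x, c) \<in> {p \<in> topspace ?P. fst p \<otimes> snd p \<in> carrier G - C}"
        using CG unfolding topP by auto
      then show "x \<in> fst ` {p \<in> topspace ?P. fst p \<otimes> snd p \<in> carrier G - C}"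
        by (rule rev_image_eqI) simp
    qed
    ultimately have "closedin ?X (carrier G - D)" by simp
    moreover have "carrier G - (carrier G - D) = D" by (auto simp: D_def)
    ultimately show ?thesis
      using openin_diff[OF openin_topspace[of ?X]] by (metis topspace_topol)
  qed
  define U where "U = D \<inter> {x \<in> carrier G. inv x \<in> D}"
  have D_mult: "x \<otimes> y \<in> D" if "x \<in> D" "y \<in> D" for x y
    using that CG by (auto simp: D_def m_assoc)
  have "\<one> \<in> D" using CG by (auto simp: D_def)
  have sub: "subgroup U G"
  proof (rule subgroupI)
    show "U \<subseteq> carrier G" by (auto simp: U_def)
    show "U \<noteq> {}" using \<open>\<one> \<in> D\<close> by (auto simp: U_def)
    show "inv a \<in> U" if "a \<in> U" for a
      using that by (auto simp: U_def)
    show "a \<otimes> b \<in> U" if "a \<in> U" "b \<in> U" for a b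
      using that D_mult by (auto simp: U_def inv_mult_group)
  qed
  have "openin ?X U" "closedin ?X U"
    unfolding U_def
    using D_open D_closed continuous_inv by (auto intro: openin_vimage closedin_vimage)
  moreover have UC: "U \<subseteq> C"
  proof
    fix x assume x: "x \<in> U"
    then have "x \<otimes> \<one> \<in> C" "x \<in> carrier G" using C(3) by (auto simp: U_def D_def)
    then show "x \<in> C" by simp
  qed
  ultimately have "compactin ?X U"
    using closed_compactin[OF C(2)] by blast
  then show thesis
    using that sub \<open>openin ?X U\<close> UC C(4) by blast
qed

end


section \<open>Contractive automorphisms\<close>

text \<open>Such a subgroup \<open>W\<close> is all that is retained of total disconnectedness, local compactness and
  contractivity.\<close>

locale contractive_group = topological_group G for G :: "('a, 'b) top_group_scheme" (structure) +
  fixes \<alpha> :: "'a \<Rightarrow> 'a" and W :: "'a set"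
  assumes alpha_hom: "\<alpha> \<in> hom G G"
    and alpha_homeo: "homeomorphic_map (topol G) (topol G) \<alpha>"
    and W_subgroup: "subgroup W G"
    and W_open: "openin (topol G) W"
    and W_compact: "compactin (topol G) W"
    and alpha_W: "x \<in> W \<Longrightarrow> \<alpha> x \<in> W"
    and absorbed: "x \<in> carrier G \<Longrightarrow> \<exists>n. (\<alpha> ^^ n) x \<in> W"
    and uniform: "openin (topol G) V \<Longrightarrow> \<one> \<in> V \<Longrightarrow> \<exists>n. \<forall>x\<in>W. (\<alpha> ^^ n) x \<in> V"

context topological_group
begin

lemma homeomorphic_map_funpow:
  "homeomorphic_map (topol G) (topol G) f \<Longrightarrow> homeomorphic_map (topol G) (topol G) (f ^^ n)"
  by (induction n) (auto simp: homeomorphic_map_id intro: homeomorphic_map_compose)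

lemma funpow_hom: "f \<in> hom G G \<Longrightarrow> (f ^^ n) \<in> hom G G"
proof (induction n)
  case 0
  then show ?case by (auto simp: hom_def)
next
  case (Suc n)
  then show ?case using Group.hom_compose[OF Suc.IH[OF Suc.prems] Suc.prems] by (simp add: o_def)
qed

lemma subgroup_hom_vimage:
  assumes "f \<in> hom G G" "subgroup H G"
  shows "subgroup {x \<in> carrier G. f x \<in> H} G"
proof -
  interpret f: group_hom G G f
    using assms(1) by unfold_locales
  show ?thesis
    using assms(2) by (intro subgroupI)
      (auto simp: subgroup.m_closed subgroup.m_inv_closed subgroup.one_closed)
qed

text \<open>The closed subgroups \<open>V n\<close> of all points whose orbit stays in \<open>U\<close> from time \<open>n\<close> on cover \<open>G\<close>, since \<open>\<alpha>\<close>
  is contractive. By the Baire category theorem one of them has interior points and so is open. Its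
  image under the homeomorphism \<open>\<alpha>\<^sup>n\<close> is \<open>P\<close>.\<close>

lemma contractive_invariant_subgroup:
  assumes lc: "locally_compact_space (topol G)"
    and hom: "\<alpha> \<in> hom G G" and homeo: "homeomorphic_map (topol G) (topol G) \<alpha>"
    and contr: "contractive G \<alpha>"
    and U: "subgroup U G" "openin (topol G) U" "compactin (topol G) U"
  defines "P \<equiv> {x \<in> carrier G. \<forall>k. (\<alpha> ^^ k) x \<in> U}"
  shows "subgroup P G" "openin (topol G) P" "compactin (topol G) P" "P \<subseteq> U"
    "\<And>x. x \<in> P \<Longrightarrow> \<alpha> x \<in> P" "\<And>x. x \<in> carrier G \<Longrightarrow> \<exists>n. (\<alpha> ^^ n) x \<in> P"
proof -
  let ?X = "topol G"
  note hom_n = funpow_hom[OF hom] and homeo_n = homeomorphic_map_funpow[OF homeo]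
  have cont_n: "continuous_map ?X ?X (\<alpha> ^^ n)" for n
    using homeo_n homeomorphic_imp_continuous_map by blast
  have carr_n: "(\<alpha> ^^ n) x \<in> carrier G" if "x \<in> carrier G" for n x
    using hom_n[of n] that by (auto simp: hom_def)
  have U_closed: "closedin ?X U"
    using U(3) Hausdorff_topol compactin_imp_closedin by blast
  define V where "V = (\<lambda>n. {x \<in> carrier G. \<forall>k\<ge>n. (\<alpha> ^^ k) x \<in> U})"
  have V_eq: "V n = (\<Inter>k\<in>{n..}. {x \<in> carrier G. (\<alpha> ^^ k) x \<in> U})" for n
    by (auto simp: V_def)
  have V_sub: "subgroup (V n) G" for n
    unfolding V_eq by (rule subgroups_Inter) (auto intro: subgroup_hom_vimage hom_n U(1))
  have V_closed: "closedin ?X (V n)" for n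
    unfolding V_eq by (intro closedin_INT closedin_vimage cont_n U_closed) auto
  have V_Union: "x \<in> (\<Union>n. V n)" if x: "x \<in> carrier G" for x
  proof -
    have "limitin ?X (\<lambda>n. (\<alpha> ^^ n) x) \<one> sequentially"
      using contr x by (simp add: contractive_def)
    then have "\<forall>\<^sub>F n in sequentially. (\<alpha> ^^ n) x \<in> U"
      using U(2) subgroup.one_closed[OF U(1)] by (auto simp: limitin_def)
    then show ?thesis
      using x by (auto simp: V_def eventually_sequentially)
  qed
  have "\<exists>n. ?X interior_of V n \<noteq> {}"
  proof (rule ccontr)
    assume no: "\<nexists>n. ?X interior_of V n \<noteq> {}"
    have "?X interior_of \<Union>(range V) = {}"
    proof (rule Baire_category_alt)
      show "completely_metrizable_space ?X \<or> locally_compact_space ?X \<and> regular_space ?X"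
        using lc Hausdorff_topol locally_compact_Hausdorff_imp_regular_space by blast
    qed (use no V_closed in auto)
    moreover have "\<Union>(range V) = topspace ?X"
      using V_Union by (auto simp: topspace_topol V_def)
    ultimately show False
      using one_closed interior_of_topspace[of ?X] unfolding topspace_topol by auto
  qed
  then obtain n where "?X interior_of V n \<noteq> {}" by blast
  then have V_open: "openin ?X (V n)"
    using subgroup_openin_of_interior[OF V_sub, of "?X interior_of V n"]
    by (simp add: interior_of_subset)
  have P_image: "P = (\<alpha> ^^ n) ` V n"
  proof
    have surj: "(\<alpha> ^^ n) ` carrier G = carrier G"
      using homeo_n[of n] homeomorphic_imp_surjective_map[of ?X ?X "\<alpha> ^^ n"]
      by (simp add: topspace_topol)
    show "P \<subseteq> (\<alpha> ^^ n) ` V n"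
    proof
      fix x assume x: "x \<in> P"
      then have "x \<in> (\<alpha> ^^ n) ` carrier G" unfolding surj by (simp add: P_def)
      then obtain y where y: "y \<in> carrier G" "x = (\<alpha> ^^ n) y" by blast
      have "(\<alpha> ^^ k) y \<in> U" if "k \<ge> n" for k
      proof -
        have "(\<alpha> ^^ k) y = (\<alpha> ^^ (k - n)) x"
          using that y(2) funpow_add[of "k - n" n \<alpha>] by simp
        then show ?thesis using x by (simp add: P_def)
      qed
      then show "x \<in> (\<alpha> ^^ n) ` V n" using y by (auto simp: V_def)
    qed
    show "(\<alpha> ^^ n) ` V n \<subseteq> P"
    proof
      fix x assume "x \<in> (\<alpha> ^^ n) ` V n"
      then obtain y where y: "y \<in> V n" "x = (\<alpha> ^^ n) y" by blast
      have "(\<alpha> ^^ k) x = (\<alpha> ^^ (k + n)) y" for k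
        using y(2) funpow_add[of k n \<alpha>] by simp
      then show "x \<in> P"
        using y carr_n by (simp add: P_def V_def)
    qed
  qed
  show "openin ?X P"
    unfolding P_image
    using V_open homeo_n[of n] homeomorphic_map_openness_eq by blast
  have P_V: "P = V 0" by (auto simp: P_def V_def)
  show "subgroup P G" unfolding P_V by (rule V_sub)
  show PU: "P \<subseteq> U"
  proof
    fix x assume "x \<in> P"
    then have "(\<alpha> ^^ 0) x \<in> U" unfolding P_def by blast
    then show "x \<in> U" by simp
  qed
  show "compactin ?X P"
    using closed_compactin[OF U(3) PU] V_closed[of 0] P_V by simp
  show "\<alpha> x \<in> P" if "x \<in> P" for x
  proof -
    have "(\<alpha> ^^ k) (\<alpha> x) \<in> U" for k
      using that unfolding P_def by (metis (mono_tags, lifting) funpow_swap1 funpow.simps(2) comp_apply mem_Collect_eq)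
    moreover have "\<alpha> x \<in> carrier G"
      using carr_n[of x 1] that by (simp add: P_def)
    ultimately show ?thesis by (simp add: P_def)
  qed
  show "\<exists>n. (\<alpha> ^^ n) x \<in> P" if x: "x \<in> carrier G" for x
  proof -
    obtain n where "x \<in> V n" using V_Union[OF x] by blast
    then have "(\<alpha> ^^ (k + n)) x \<in> U" for k
      unfolding V_def by simp
    then have "(\<alpha> ^^ k) ((\<alpha> ^^ n) x) \<in> U" for k
      by (simp add: funpow_add)
    then show ?thesis
      using carr_n[OF x] by (auto simp: P_def)
  qed
qed

text \<open>Contractivity is uniform on the compact set \<open>W\<close>: a given neighbourhood of \<open>1\<close> contains an \<open>\<alpha>\<close>-invariant
  open subgroup \<open>P\<close>, the preimages of \<open>P\<close> under the powers of \<open>\<alpha>\<close> form an increasing open cover, and so one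
  of them contains \<open>W\<close>.\<close>

theorem contractive_group_exists:
  assumes td: "totally_disconnected_space (topol G)" and lc: "locally_compact_space (topol G)"
    and hom: "\<alpha> \<in> hom G G" and homeo: "homeomorphic_map (topol G) (topol G) \<alpha>"
    and contr: "contractive G \<alpha>"
  shows "\<exists>W. contractive_group G \<alpha> W"
proof -
  let ?X = "topol G"
  let ?P = "\<lambda>U. {x \<in> carrier G. \<forall>k. (\<alpha> ^^ k) x \<in> U}"
  have cont_n: "continuous_map ?X ?X (\<alpha> ^^ n)" for n
    using homeomorphic_map_funpow[OF homeo] homeomorphic_imp_continuous_map by blast
  note inv = contractive_invariant_subgroup[OF lc hom homeo contr]
  have "openin ?X (carrier G)" by (metis openin_topspace topspace_topol)
  then obtain U where U: "subgroup U G" "openin ?X U" "compactin ?X U"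
    using compact_open_subgroup[OF td lc] one_closed by metis
  let ?W = "?P U"
  have "\<exists>n. \<forall>x\<in>?W. (\<alpha> ^^ n) x \<in> V" if V: "openin ?X V" "\<one> \<in> V" for V
  proof -
    obtain U' where U': "subgroup U' G" "openin ?X U'" "compactin ?X U'" "U' \<subseteq> V"
      using compact_open_subgroup[OF td lc V] by metis
    note P = inv[OF U'(1-3)]
    define T where "T = (\<lambda>n. {x \<in> carrier G. (\<alpha> ^^ n) x \<in> ?P U'})"
    have T_open: "openin ?X (T n)" for n
      unfolding T_def by (rule openin_vimage[OF cont_n P(2)])
    have "?W \<subseteq> \<Union>(range T)"
      using P(6) by (auto simp: T_def)
    then have "\<exists>F. finite F \<and> F \<subseteq> range T \<and> ?W \<subseteq> \<Union>F"
      by (intro compactinD[OF inv(3)[OF U]]) (use T_open in blast)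
    then obtain F where F: "finite F" "F \<subseteq> range T" "?W \<subseteq> \<Union>F"
      by blast
    then obtain N where N: "finite N" "F = T ` N"
      using finite_subset_image[OF F(1,2)] by blast
    have up: "(\<alpha> ^^ (k + n)) x \<in> ?P U'" if "(\<alpha> ^^ n) x \<in> ?P U'" for k n x
      using that P(5) by (induction k) auto
    have "(\<alpha> ^^ Max (insert 0 N)) x \<in> V" if x: "x \<in> ?W" for x
    proof -
      obtain n where n: "n \<in> N" "x \<in> T n" using x F(3) N(2) by blast
      then have "n \<le> Max (insert 0 N)" using N(1) by simp
      then have "(\<alpha> ^^ Max (insert 0 N)) x \<in> ?P U'"
        using up[of n x "Max (insert 0 N) - n"] n(2) by (simp add: T_def)
      then show ?thesis using P(4) U'(4) by blast
    qed
    then show ?thesis by blast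
  qed
  then have "contractive_group G \<alpha> ?W"
    using inv[OF U] hom homeo
    by (intro contractive_group.intro contractive_group_axioms.intro topological_group_axioms) auto
  then show ?thesis ..
qed

end


context contractive_group
begin

lemma alpha_n_closed: "x \<in> carrier G \<Longrightarrow> (\<alpha> ^^ n) x \<in> carrier G"
  using funpow_hom[OF alpha_hom, of n] by (auto simp: hom_def)

lemma alpha_n_mult:
  "x \<in> carrier G \<Longrightarrow> y \<in> carrier G \<Longrightarrow> (\<alpha> ^^ n) (x \<otimes> y) = (\<alpha> ^^ n) x \<otimes> (\<alpha> ^^ n) y"
  using hom_mult[OF funpow_hom[OF alpha_hom]] .

lemma alpha_n_W: "x \<in> W \<Longrightarrow> (\<alpha> ^^ n) x \<in> W"
  by (induction n) (auto intro: alpha_W)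

lemma alpha_n_inj: "inj_on (\<alpha> ^^ n) (carrier G)"
  using homeomorphic_imp_injective_map[OF homeomorphic_map_funpow[OF alpha_homeo]]
  by (simp add: topspace_topol)

lemma alpha_n_surj: "(\<alpha> ^^ n) ` carrier G = carrier G"
  using homeomorphic_imp_surjective_map[OF homeomorphic_map_funpow[OF alpha_homeo]]
  by (simp add: topspace_topol)

lemma alpha_n_cont: "continuous_map (topol G) (topol G) (\<alpha> ^^ n)"
  using homeomorphic_imp_continuous_map[OF homeomorphic_map_funpow[OF alpha_homeo]] .

lemma W_carrier: "x \<in> W \<Longrightarrow> x \<in> carrier G"
  using subgroup.mem_carrier[OF W_subgroup] .

lemma W_closed: "closedin (topol G) W"
  using W_compact Hausdorff_topol compactin_imp_closedin by blast

lemma absorbed_add: "(\<alpha> ^^ n) x \<in> W \<Longrightarrow> (\<alpha> ^^ (k + n)) x \<in> W"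
  using alpha_n_W by (simp add: funpow_add)

text \<open>Since \<open>\<alpha>\<close> is bijective, the second condition says \<open>\<alpha> H = H\<close>.\<close>

definition stable :: "'a set \<Rightarrow> bool" where
  "stable H \<longleftrightarrow> subgroup H G \<and> (\<forall>x\<in>carrier G. \<alpha> x \<in> H \<longleftrightarrow> x \<in> H)"

lemma stable_subgroup: "stable H \<Longrightarrow> subgroup H G"
  by (simp add: stable_def)

lemma stable_funpow:
  assumes "stable H" "x \<in> carrier G"
  shows "(\<alpha> ^^ n) x \<in> H \<longleftrightarrow> x \<in> H"
proof (induction n)
  case (Suc n)
  then show ?case
    using assms alpha_n_closed[of x n] by (simp add: stable_def)
qed simp

lemma stable_set_mult:
  assumes N: "stable N" and H: "stable H" and norm: "normalizes G H N"
  shows "stable (N <#> H)"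
proof -
  have sub: "subgroup N G" "subgroup H G" using N H by (simp_all add: stable_def)
  have NG: "\<And>n. n \<in> N \<Longrightarrow> n \<in> carrier G" and HG: "\<And>h. h \<in> H \<Longrightarrow> h \<in> carrier G"
    using sub by (auto dest: subgroup.mem_carrier)
  have iff: "\<alpha> x \<in> N \<longleftrightarrow> x \<in> N" "\<alpha> x \<in> H \<longleftrightarrow> x \<in> H" if "x \<in> carrier G" for x
    using N H that by (auto simp: stable_def)
  have "\<alpha> x \<in> N <#> H \<longleftrightarrow> x \<in> N <#> H" if x: "x \<in> carrier G" for x
  proof
    assume "x \<in> N <#> H"
    then obtain n h where nh: "n \<in> N" "h \<in> H" "x = n \<otimes> h" by (auto simp: set_mult_def)
    then have "\<alpha> x = \<alpha> n \<otimes> \<alpha> h" "\<alpha> n \<in> N" "\<alpha> h \<in> H"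
      using alpha_n_mult[of n h 1] NG HG iff by auto
    then show "\<alpha> x \<in> N <#> H" by (auto simp: set_mult_def)
  next
    assume "\<alpha> x \<in> N <#> H"
    then obtain n h where nh: "n \<in> N" "h \<in> H" "\<alpha> x = n \<otimes> h" by (auto simp: set_mult_def)
    have "n \<in> \<alpha> ` carrier G" "h \<in> \<alpha> ` carrier G"
      using nh NG HG alpha_n_surj[of 1] by auto
    then obtain n' h' where n'h': "n' \<in> carrier G" "n = \<alpha> n'" "h' \<in> carrier G" "h = \<alpha> h'"
      by blast
    then have "\<alpha> x = \<alpha> (n' \<otimes> h')"
      using nh(3) alpha_n_mult[of n' h' 1] by simp
    then have "x = n' \<otimes> h'"
      using alpha_n_inj[of 1] x n'h' by (simp add: inj_on_def)
    moreover have "n' \<in> N" "h' \<in> H" using nh n'h' iff by auto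
    ultimately show "x \<in> N <#> H" by (auto simp: set_mult_def)
  qed
  then show ?thesis
    using subgroup_set_mult_normalized[OF sub norm] by (simp add: stable_def)
qed

section \<open>Absorption and chains of stable subgroups\<close>

text \<open>Substituting \<open>x = \<alpha> m k\<close> into itself repeatedly gives \<open>x \<in> \<alpha>\<^sup>n m K\<close> with \<open>m \<in> W\<close> for every \<open>n\<close>. As \<open>\<alpha>\<^sup>n W\<close>
  shrinks to \<open>1\<close>, the point \<open>x\<close> lies in the closure of \<open>K\<close>.\<close>

lemma contraction_absorb:
  assumes K: "subgroup K G" "closedin (topol G) K" "\<And>k. k \<in> K \<Longrightarrow> \<alpha> k \<in> K"
    and M: "M \<subseteq> W" and step: "\<And>x. x \<in> M \<Longrightarrow> \<exists>m\<in>M. \<exists>k\<in>K. x = \<alpha> m \<otimes> k"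
  shows "M \<subseteq> K"
proof
  fix x assume x: "x \<in> M"
  have KG: "\<And>k. k \<in> K \<Longrightarrow> k \<in> carrier G" using subgroup.mem_carrier[OF K(1)] .
  have MG: "\<And>m. m \<in> M \<Longrightarrow> m \<in> carrier G" using M W_carrier by blast
  have alpha_n_K: "(\<alpha> ^^ n) k \<in> K" if "k \<in> K" for n k
    using that K(3) by (induction n) auto
  have iter: "\<exists>m\<in>M. \<exists>k\<in>K. x = (\<alpha> ^^ n) m \<otimes> k" for n
  proof (induction n)
    case 0
    have "x = x \<otimes> \<one>" using MG[OF x] by simp
    then show ?case using x subgroup.one_closed[OF K(1)] by auto
  next
    case (Suc n)
    then obtain m k where mk: "m \<in> M" "k \<in> K" "x = (\<alpha> ^^ n) m \<otimes> k" by blast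
    obtain m' k' where m'k': "m' \<in> M" "k' \<in> K" "m = \<alpha> m' \<otimes> k'"
      using step[OF mk(1)] by blast
    have "\<alpha> m' \<in> carrier G" using alpha_n_closed[of m' 1] MG[OF m'k'(1)] by simp
    then have "(\<alpha> ^^ n) m = (\<alpha> ^^ Suc n) m' \<otimes> (\<alpha> ^^ n) k'"
      using m'k' KG by (simp add: alpha_n_mult funpow_swap1)
    then have "x = (\<alpha> ^^ Suc n) m' \<otimes> ((\<alpha> ^^ n) k' \<otimes> k)"
      using mk m'k' KG MG alpha_n_closed by (simp add: m_assoc del: funpow.simps)
    moreover have "(\<alpha> ^^ n) k' \<otimes> k \<in> K"
      using alpha_n_K[OF m'k'(2)] mk(2) subgroup.m_closed[OF K(1)] by blast
    ultimately show ?case using m'k'(1) by blast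
  qed
  show "x \<in> K"
  proof (rule ccontr)
    assume "x \<notin> K"
    define V where "V = {y \<in> carrier G. inv y \<otimes> x \<in> carrier G - K}"
    have "openin (topol G) (topspace (topol G) - K)"
      using K(2) by (simp add: closedin_def)
    then have "openin (topol G) V"
      unfolding V_def topspace_topol using MG[OF x] continuous_inv
      by (intro openin_vimage continuous_map_mult) (simp_all add: topspace_topol)
    moreover have "\<one> \<in> V"
      using MG[OF x] \<open>x \<notin> K\<close> by (simp add: V_def)
    ultimately obtain n where n: "\<forall>w\<in>W. (\<alpha> ^^ n) w \<in> V"
      using uniform by blast
    obtain m k where mk: "m \<in> M" "k \<in> K" "x = (\<alpha> ^^ n) m \<otimes> k"
      using iter by blast
    have "inv ((\<alpha> ^^ n) m) \<otimes> x = k"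
      using mk KG MG alpha_n_closed by (simp flip: m_assoc)
    moreover have "inv ((\<alpha> ^^ n) m) \<otimes> x \<notin> K"
      using n mk(1) M by (auto simp: V_def)
    ultimately show False using mk(2) by simp
  qed
qed

definition cosets_met :: "'a set \<Rightarrow> 'a set set" where
  "cosets_met M = (\<lambda>x. (\<alpha> ` W) #> x) ` (M \<inter> W)"

lemma cosets_met_mono: "M \<subseteq> M' \<Longrightarrow> cosets_met M \<subseteq> cosets_met M'"
  by (auto simp: cosets_met_def)

lemma alpha_W_subgroup: "subgroup (\<alpha> ` W) G"
proof -
  interpret a: group_hom G G \<alpha>
    using alpha_hom by unfold_locales
  show ?thesis
    using a.subgroup_img_is_subgroup[OF W_subgroup] .
qed

text \<open>The open subgroup \<open>\<alpha> W\<close> has finite index in the compact group \<open>W\<close>.\<close>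

lemma finite_cosets_met: "finite (cosets_met M)"
proof -
  have op: "openin (topol G) (\<alpha> ` W)"
    using W_open alpha_homeo homeomorphic_map_openness_eq by blast
  let ?C = "cosets_met W"
  have "\<exists>F. finite F \<and> F \<subseteq> ?C \<and> W \<subseteq> \<Union>F"
  proof (rule compactinD[OF W_compact])
    show "openin (topol G) C" if "C \<in> ?C" for C
      using that openin_r_coset[OF op] W_carrier by (auto simp: cosets_met_def)
    show "W \<subseteq> \<Union>?C"
      using rcos_self[OF _ alpha_W_subgroup] W_carrier by (auto simp: cosets_met_def)
  qed
  then obtain F where F: "finite F" "F \<subseteq> ?C" "W \<subseteq> \<Union>F" by blast
  have "?C \<subseteq> F"
  proof
    fix C assume "C \<in> ?C"
    then obtain x where x: "x \<in> W" "C = \<alpha> ` W #> x" by (auto simp: cosets_met_def)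
    then obtain D where D: "D \<in> F" "x \<in> D" using F(3) by blast
    then obtain y where "y \<in> W" "D = \<alpha> ` W #> y"
      using F(2) by (auto simp: cosets_met_def)
    with D have y: "y \<in> W" "\<alpha> ` W #> y \<in> F" "x \<in> \<alpha> ` W #> y" by auto
    then have "\<alpha> ` W #> y = C"
      using repr_independence[OF y(3) W_carrier[OF y(1)] alpha_W_subgroup] x(2) by simp
    then show "C \<in> F" using y(2) by simp
  qed
  then have "finite ?C" using F(1) finite_subset by blast
  moreover have "cosets_met M \<subseteq> ?C" by (auto simp: cosets_met_def)
  ultimately show ?thesis using finite_subset by blast
qed

text \<open>If \<open>x \<in> L \<inter> W\<close> lies in the same coset of \<open>\<alpha> W\<close> as \<open>y \<in> K\<close>, then \<open>x = \<alpha> w y\<close> with \<open>w \<in> W\<close>, and stability of \<open>L\<close>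
  puts \<open>w\<close> into \<open>L\<close>. So the absorption principle applies to \<open>L \<inter> W\<close>.\<close>

lemma stable_Int_W_subset:
  assumes L: "stable L" and K: "subgroup K G" "closedin (topol G) K" "\<And>k. k \<in> K \<Longrightarrow> \<alpha> k \<in> K"
    and KL: "K \<subseteq> L" and met: "cosets_met L \<subseteq> cosets_met K"
  shows "L \<inter> W \<subseteq> K"
proof (rule contraction_absorb[OF K])
  show "L \<inter> W \<subseteq> W" by blast
  fix x assume x: "x \<in> L \<inter> W"
  have sub: "subgroup L G" using L by (simp add: stable_def)
  have "\<alpha> ` W #> x \<in> cosets_met K"
    using met x by (auto simp: cosets_met_def)
  then obtain y where y: "y \<in> K" "y \<in> W" "\<alpha> ` W #> x = \<alpha> ` W #> y"
    by (auto simp: cosets_met_def)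
  have G: "x \<in> carrier G" "y \<in> carrier G" using x y W_carrier by auto
  have "x \<otimes> inv y \<in> \<alpha> ` W"
    using y(3) rcos_eq_iff[OF alpha_W_subgroup G] by simp
  then obtain w where w: "w \<in> W" "x \<otimes> inv y = \<alpha> w" by auto
  have "\<alpha> w \<in> L"
    using x y(1) KL sub unfolding w(2)[symmetric]
    by (auto intro!: subgroup.m_closed subgroup.m_inv_closed)
  then have "w \<in> L" using L W_carrier[OF w(1)] by (auto simp: stable_def)
  moreover have "x = \<alpha> w \<otimes> y"
    unfolding w(2)[symmetric] using G by (simp add: m_assoc)
  ultimately show "\<exists>m\<in>L \<inter> W. \<exists>k\<in>K. x = \<alpha> m \<otimes> k" using w(1) y(1) by blast
qed

text \<open>The number of cosets met is a strictly monotone measure of closed stable subgroups: from equality of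
  the numbers one gets \<open>H \<inter> W \<subseteq> N\<close>, and a power of \<open>\<alpha>\<close> moves any element of \<open>H\<close> into \<open>W\<close>.\<close>

lemma stable_eq_of_card_cosets_met:
  assumes N: "stable N" "closedin (topol G) N" and H: "stable H" and NH: "N \<subseteq> H"
    and card: "card (cosets_met H) \<le> card (cosets_met N)"
  shows "N = H"
proof -
  have "cosets_met N = cosets_met H"
    using card_seteq[OF finite_cosets_met cosets_met_mono[OF NH] card] .
  moreover have "cosets_met (N \<inter> W) = cosets_met N" by (simp add: cosets_met_def)
  ultimately have "H \<inter> W \<subseteq> N \<inter> W"
    using N NH W_subgroup W_closed alpha_W
    by (intro stable_Int_W_subset[OF H])
      (auto simp: stable_def subgroups_Inter_pair closedin_Int W_carrier)
  have "x \<in> N" if x: "x \<in> H" for x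
  proof -
    have xG: "x \<in> carrier G" using x H subgroup.mem_carrier by (auto simp: stable_def)
    obtain n where "(\<alpha> ^^ n) x \<in> W" using absorbed[OF xG] by blast
    then have "(\<alpha> ^^ n) x \<in> N"
      using \<open>H \<inter> W \<subseteq> N \<inter> W\<close> stable_funpow[OF H xG] x by blast
    then show ?thesis using stable_funpow[OF N(1) xG] by simp
  qed
  then show ?thesis using NH by blast
qed

lemma card_chain_of_stable_subgroups:
  assumes S: "\<And>H. H \<in> S \<Longrightarrow> stable H \<and> closedin (topol G) H"
    and chain: "\<And>H K. H \<in> S \<Longrightarrow> K \<in> S \<Longrightarrow> H \<subseteq> K \<or> K \<subseteq> H"
  shows "card S \<le> Suc (card (cosets_met (carrier G)))"
proof -
  let ?d = "\<lambda>H. card (cosets_met H)"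
  have "inj_on ?d S"
  proof (rule inj_onI)
    fix H K assume *: "H \<in> S" "K \<in> S" "?d H = ?d K"
    then show "H = K"
      using chain[of H K] S[of H] S[of K] stable_eq_of_card_cosets_met[of H K]
        stable_eq_of_card_cosets_met[of K H] by auto
  qed
  moreover have "?d ` S \<subseteq> {..?d (carrier G)}"
  proof
    fix d assume "d \<in> ?d ` S"
    then obtain H where H: "H \<in> S" "d = ?d H" by blast
    then have "H \<subseteq> carrier G" using S[of H] subgroup.subset by (auto simp: stable_def)
    then show "d \<in> {..?d (carrier G)}"
      using H card_mono[OF finite_cosets_met cosets_met_mono] by auto
  qed
  ultimately have "card S \<le> card {..?d (carrier G)}"
    by (intro card_inj_on_le) auto
  then show ?thesis by simp
qed

section \<open>Products of stable subgroups\<close>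

text \<open>The compact subgroups \<open>K n\<close> on the right-hand side increase with \<open>n\<close> and exhaust \<open>NH \<inter> W\<close>, as a power of
  \<open>\<alpha>\<close> moves both factors of a product into \<open>W\<close>. Since only finitely many cosets of \<open>\<alpha> W\<close> are available,
  some \<open>K n\<close> meets all those that \<open>NH\<close> meets, and is then all of \<open>NH \<inter> W\<close>.\<close>

lemma set_mult_Int_W:
  assumes N: "stable N" "closedin (topol G) N" and H: "stable H" "closedin (topol G) H"
    and norm: "normalizes G H N"
  obtains n where "(N <#> H) \<inter> W = {x \<in> W. (\<alpha> ^^ n) x \<in> (N \<inter> W) <#> (H \<inter> W)}"
    and "closedin (topol G) ((N <#> H) \<inter> W)"
proof -
  let ?K0 = "(N \<inter> W) <#> (H \<inter> W)" and ?L = "N <#> H"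
  define K where "K = (\<lambda>n. {x \<in> W. (\<alpha> ^^ n) x \<in> ?K0})"
  have sub: "subgroup N G" "subgroup H G" "subgroup (N \<inter> W) G" "subgroup (H \<inter> W) G"
    using N H W_subgroup by (auto simp: stable_def subgroups_Inter_pair)
  have L: "stable ?L" using stable_set_mult[OF N(1) H(1) norm] .
  have "normalizes G (H \<inter> W) (N \<inter> W)"
    using norm W_subgroup by (auto simp: normalizes_def subgroup.m_closed subgroup.m_inv_closed)
  then have K0_sub: "subgroup ?K0 G"
    using subgroup_set_mult_normalized[OF sub(3,4)] by blast
  have NG: "\<And>n. n \<in> N \<Longrightarrow> n \<in> carrier G" and HG: "\<And>h. h \<in> H \<Longrightarrow> h \<in> carrier G"
    using sub(1,2) by (auto dest: subgroup.mem_carrier)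
  have K0_closed: "closedin (topol G) ?K0"
  proof -
    have "compactin (topol G) (N \<inter> W)" "compactin (topol G) (H \<inter> W)"
      using N(2) H(2) W_compact by (simp_all add: closed_Int_compactin)
    then have "compactin (prod_topology (topol G) (topol G)) ((N \<inter> W) \<times> (H \<inter> W))"
      by (simp add: compactin_Times)
    then have "compactin (topol G) ((\<lambda>(x, y). x \<otimes> y) ` ((N \<inter> W) \<times> (H \<inter> W)))"
      using image_compactin continuous_mult by blast
    moreover have "(\<lambda>(x, y). x \<otimes> y) ` ((N \<inter> W) \<times> (H \<inter> W)) = ?K0"
      by (force simp: set_mult_def)
    ultimately show ?thesis
      using Hausdorff_topol compactin_imp_closedin by fastforce
  qed
  have K0_alpha: "\<alpha> x \<in> ?K0" if x: "x \<in> ?K0" for x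
  proof -
    obtain n h where nh: "n \<in> N \<inter> W" "h \<in> H \<inter> W" "x = n \<otimes> h"
      using x by (auto simp: set_mult_def)
    then have "\<alpha> x = \<alpha> n \<otimes> \<alpha> h"
      using alpha_n_mult[of n h 1] NG HG by simp
    moreover have "\<alpha> n \<in> N \<inter> W" "\<alpha> h \<in> H \<inter> W"
      using nh N(1) H(1) NG HG alpha_W by (auto simp: stable_def)
    ultimately show ?thesis by (auto simp: set_mult_def)
  qed
  have K_eq: "K n = W \<inter> {x \<in> carrier G. (\<alpha> ^^ n) x \<in> ?K0}" for n
    using W_carrier by (auto simp: K_def)
  have K_sub: "subgroup (K n) G" for n
    unfolding K_eq
    by (intro subgroups_Inter_pair W_subgroup subgroup_hom_vimage funpow_hom alpha_hom K0_sub)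
  have K_closed: "closedin (topol G) (K n)" for n
    unfolding K_eq
    by (intro closedin_Int W_closed closedin_vimage alpha_n_cont K0_closed)
  have K_alpha: "\<alpha> x \<in> K n" if "x \<in> K n" for n x
    using that alpha_W K0_alpha by (auto simp: K_def simp flip: funpow_swap1)
  have K_mono: "K m \<subseteq> K n" if "m \<le> n" for m n
  proof -
    have "(\<alpha> ^^ (k + m)) x \<in> ?K0" if "x \<in> K m" for x k
      using that K0_alpha by (induction k) (auto simp: K_def)
    from this[of _ "n - m"] show ?thesis
      using that by (auto simp: K_def)
  qed
  have K0_L: "?K0 \<subseteq> ?L" by (auto simp: set_mult_def)
  have K_L: "K n \<subseteq> ?L" for n
  proof
    fix x assume x: "x \<in> K n"
    then have "(\<alpha> ^^ n) x \<in> ?L" using K0_L by (auto simp: K_def)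
    then show "x \<in> ?L" using stable_funpow[OF L] x W_carrier by (auto simp: K_def)
  qed
  have exhaust: "\<exists>n. x \<in> K n" if x: "x \<in> ?L \<inter> W" for x
  proof -
    obtain a b where ab: "a \<in> N" "b \<in> H" "x = a \<otimes> b" using x by (auto simp: set_mult_def)
    obtain i j where ij: "(\<alpha> ^^ i) a \<in> W" "(\<alpha> ^^ j) b \<in> W"
      using absorbed NG HG ab by metis
    let ?n = "i + j"
    have "(\<alpha> ^^ ?n) a \<in> N \<inter> W"
      using absorbed_add[OF ij(1), of j] stable_funpow[OF N(1) NG[OF ab(1)]] ab(1)
      by (simp add: add.commute)
    moreover have "(\<alpha> ^^ ?n) b \<in> H \<inter> W"
      using absorbed_add[OF ij(2), of i] stable_funpow[OF H(1) HG[OF ab(2)]] ab(2) by simp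
    moreover have "(\<alpha> ^^ ?n) x = (\<alpha> ^^ ?n) a \<otimes> (\<alpha> ^^ ?n) b"
      using ab NG HG alpha_n_mult by simp
    ultimately have "(\<alpha> ^^ ?n) x \<in> ?K0" by (auto simp: set_mult_def)
    then show ?thesis using x by (auto simp: K_def)
  qed
  have "\<exists>n. cosets_met ?L \<subseteq> cosets_met (K n)"
  proof -
    have "\<forall>C\<in>cosets_met ?L. \<exists>n. C \<in> cosets_met (K n)"
    proof
      fix C assume "C \<in> cosets_met ?L"
      then obtain x where x: "x \<in> ?L \<inter> W" "C = \<alpha> ` W #> x" by (auto simp: cosets_met_def)
      then show "\<exists>n. C \<in> cosets_met (K n)"
        using exhaust[OF x(1)] by (auto simp: cosets_met_def)
    qed
    then obtain f where f: "\<forall>C\<in>cosets_met ?L. C \<in> cosets_met (K (f C))" by metis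
    have "C \<in> cosets_met (K (Max (f ` cosets_met ?L)))" if "C \<in> cosets_met ?L" for C
      using f that finite_cosets_met cosets_met_mono[OF K_mono, of "f C"] by (meson Max_ge finite_imageI imageI subsetD)
    then show ?thesis by blast
  qed
  then obtain n where n: "cosets_met ?L \<subseteq> cosets_met (K n)" by blast
  have "?L \<inter> W \<subseteq> K n"
    by (rule stable_Int_W_subset[OF L K_sub K_closed K_alpha K_L n])
  then have "?L \<inter> W = K n"
    using K_L by (auto simp: K_def)
  then show thesis
    using that[of n] K_closed[of n] by (simp add: K_def)
qed

text \<open>Being closed is a local property, and the open coset \<open>W x\<close> of a point \<open>x\<close> either misses \<open>L\<close> or meets it in
  a translate of \<open>L \<inter> W\<close>.\<close>

lemma closedin_of_Int_W:
  assumes L: "subgroup L G" and LW: "closedin (topol G) (L \<inter> W)"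
  shows "closedin (topol G) L"
proof -
  have LG: "\<And>x. x \<in> L \<Longrightarrow> x \<in> carrier G" using subgroup.mem_carrier[OF L] .
  have "\<exists>T. openin (topol G) T \<and> x \<in> T \<and> T \<subseteq> carrier G - L" if x: "x \<in> carrier G - L" for x
  proof (cases "(W #> x) \<inter> L = {}")
    case True
    have "W #> x \<subseteq> carrier G"
      using x W_carrier by (auto simp: r_coset_def)
    then show ?thesis
      using True x openin_r_coset[OF W_open, of x] rcos_self[OF _ W_subgroup, of x] by blast
  next
    case False
    then obtain w where w: "w \<in> W" "w \<otimes> x \<in> L" by (auto simp: r_coset_def)
    let ?l = "w \<otimes> x" and ?T = "W - (L \<inter> W)"
    have G: "w \<in> carrier G" "x \<in> carrier G" using w x W_carrier by auto
    have "openin (topol G) ?T"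
      using W_open LW by (rule openin_diff)
    then have "openin (topol G) (?T #> ?l)"
      using G by (intro openin_r_coset) auto
    moreover have "x \<in> ?T #> ?l"
    proof -
      have xw: "x = inv w \<otimes> ?l" using G by (simp flip: m_assoc)
      then have "inv w \<notin> L"
        using x w(2) subgroup.m_closed[OF L] by (metis DiffD2)
      moreover have "inv w \<in> W" using w W_subgroup by (simp add: subgroup.m_inv_closed)
      ultimately show ?thesis using xw unfolding r_coset_def by blast
    qed
    moreover have "?T #> ?l \<subseteq> carrier G - L"
    proof
      fix y assume "y \<in> ?T #> ?l"
      then obtain v where v: "v \<in> W" "v \<notin> L" "y = v \<otimes> ?l" by (auto simp: r_coset_def)
      have vG: "v \<in> carrier G" using v W_carrier by blast
      have "v = y \<otimes> inv ?l" using v(3) vG G by (simp add: m_assoc)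
      then have "y \<notin> L"
        using v(2) w(2) subgroup.m_closed[OF L] subgroup.m_inv_closed[OF L] by metis
      then show "y \<in> carrier G - L" using v(3) vG G by simp
    qed
    ultimately show ?thesis by blast
  qed
  then have "openin (topol G) (carrier G - L)"
    by (subst openin_subopen) blast
  then show ?thesis
    using LG by (auto simp: closedin_def topspace_topol)
qed

lemma closedin_set_mult:
  assumes "stable N" "closedin (topol G) N" "stable H" "closedin (topol G) H" "normalizes G H N"
  shows "closedin (topol G) (N <#> H)"
  using set_mult_Int_W[OF assms] closedin_of_Int_W stable_set_mult[OF assms(1,3,5)]
  by (metis stable_def)

text \<open>Near \<open>a u\<close>, with \<open>a \<in> N\<close> and \<open>u \<in> U\<close>, the product \<open>NH\<close> consists of elements \<open>a \<alpha>\<^sup>m\<^sup>+\<^sup>p w u\<close> with \<open>w \<in> NH \<inter> W\<close>.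
  Choosing \<open>p\<close> such that \<open>\<alpha>\<^sup>p\<close> splits \<open>NH \<inter> W\<close> into \<open>(N \<inter> W) (H \<inter> W)\<close>, and \<open>m\<close> so large that \<open>\<alpha>\<^sup>m W u\<close> is
  contained in a given neighbourhood of \<open>u\<close>, yields an element of \<open>NU\<close>.\<close>

lemma openin_set_mult:
  assumes N: "stable N" "closedin (topol G) N" and H: "stable H" "closedin (topol G) H"
    and norm: "normalizes G H N" and U: "openin (subtopology (topol G) H) U"
  shows "openin (subtopology (topol G) (N <#> H)) (N <#> U)"
proof -
  let ?L = "N <#> H"
  have sub: "subgroup N G" "subgroup H G" using N H by (auto simp: stable_def)
  have L: "stable ?L" using stable_set_mult[OF N(1) H(1) norm] .
  have NG: "\<And>n. n \<in> N \<Longrightarrow> n \<in> carrier G" and HG: "\<And>h. h \<in> H \<Longrightarrow> h \<in> carrier G"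
    using sub by (auto dest: subgroup.mem_carrier)
  obtain O' where O': "openin (topol G) O'" "U = O' \<inter> H"
    using U by (auto simp: openin_subtopology)
  obtain p where p: "?L \<inter> W = {x \<in> W. (\<alpha> ^^ p) x \<in> (N \<inter> W) <#> (H \<inter> W)}"
    using set_mult_Int_W[OF N H norm] by metis
  have "\<exists>T. openin (topol G) T \<and> y \<in> T \<and> T \<inter> ?L \<subseteq> N <#> U" if y: "y \<in> N <#> U" for y
  proof -
    obtain a u where au: "a \<in> N" "u \<in> U" "y = a \<otimes> u" using y by (auto simp: set_mult_def)
    have uH: "u \<in> H" "u \<in> O'" using au O' by auto
    have G: "a \<in> carrier G" "u \<in> carrier G" using au uH NG HG by auto
    have "openin (topol G) {z \<in> carrier G. z \<otimes> u \<in> O'}"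
      by (rule openin_vimage[OF continuous_map_rmult[OF G(2)] O'(1)])
    moreover have "\<one> \<in> {z \<in> carrier G. z \<otimes> u \<in> O'}" using G uH by simp
    ultimately obtain m where m: "\<forall>w\<in>W. (\<alpha> ^^ m) w \<in> {z \<in> carrier G. z \<otimes> u \<in> O'}"
      using uniform by metis
    let ?A = "(\<alpha> ^^ (m + p)) ` W"
    have "openin (topol G) ?A"
      using W_open homeomorphic_map_funpow[OF alpha_homeo] homeomorphic_map_openness_eq by blast
    then have T_open: "openin (topol G) (a <# (?A #> u))"
      using G by (intro openin_l_coset openin_r_coset)
    have "\<one> \<in> ?A"
      using subgroup.one_closed[OF W_subgroup] hom_one[OF funpow_hom[OF alpha_hom, of "m + p"]] is_group
      by (metis imageI)
    moreover have "y = a \<otimes> (\<one> \<otimes> u)" using au G by simp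
    ultimately have "y \<in> a <# (?A #> u)"
      unfolding l_coset_def r_coset_def by blast
    moreover have "(a <# (?A #> u)) \<inter> ?L \<subseteq> N <#> U"
    proof
      fix z assume z: "z \<in> (a <# (?A #> u)) \<inter> ?L"
      then obtain w where w: "w \<in> W" "z = a \<otimes> ((\<alpha> ^^ (m + p)) w \<otimes> u)"
        unfolding l_coset_def r_coset_def by auto
      let ?w = "(\<alpha> ^^ (m + p)) w"
      have wG: "w \<in> carrier G" "?w \<in> carrier G" using w(1) W_carrier alpha_n_closed by auto
      have "a \<in> ?L" "u \<in> ?L"
      proof -
        have "a = a \<otimes> \<one>" "u = \<one> \<otimes> u" using G by auto
        then show "a \<in> ?L" "u \<in> ?L"
          using au(1) uH(1) subgroup.one_closed[OF sub(1)] subgroup.one_closed[OF sub(2)]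
          unfolding set_mult_def by blast+
      qed
      then have "inv a \<otimes> z \<otimes> inv u \<in> ?L"
        using z stable_subgroup[OF L] by (auto intro!: subgroup.m_closed subgroup.m_inv_closed)
      moreover have "inv a \<otimes> z \<otimes> inv u = ?w"
      proof -
        have "inv a \<otimes> z = ?w \<otimes> u" using w(2) wG G by (simp flip: m_assoc)
        then show ?thesis using wG G by (simp add: m_assoc)
      qed
      ultimately have "w \<in> ?L" using stable_funpow[OF L wG(1)] by simp
      then have "(\<alpha> ^^ p) w \<in> (N \<inter> W) <#> (H \<inter> W)" using p w(1) by blast
      then obtain n h where nh: "n \<in> N \<inter> W" "h \<in> H \<inter> W" "(\<alpha> ^^ p) w = n \<otimes> h"
        by (auto simp: set_mult_def)
      have nhG: "n \<in> carrier G" "h \<in> carrier G" using nh NG HG by auto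
      have w_eq: "?w = (\<alpha> ^^ m) n \<otimes> (\<alpha> ^^ m) h"
        using nh(3) nhG by (simp add: funpow_add alpha_n_mult)
      have n': "(\<alpha> ^^ m) n \<in> N" and h': "(\<alpha> ^^ m) h \<in> H"
        using nh nhG stable_funpow[OF N(1)] stable_funpow[OF H(1)] by auto
      have "z = (a \<otimes> (\<alpha> ^^ m) n) \<otimes> ((\<alpha> ^^ m) h \<otimes> u)"
        using w(2) w_eq G NG[OF n'] HG[OF h'] by (simp add: m_assoc)
      moreover have "a \<otimes> (\<alpha> ^^ m) n \<in> N"
        using au(1) n' by (rule subgroup.m_closed[OF sub(1)])
      moreover have "(\<alpha> ^^ m) h \<otimes> u \<in> U"
        using m nh(2) subgroup.m_closed[OF sub(2) h' uH(1)] O'(2) by blast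
      ultimately show "z \<in> N <#> U" unfolding set_mult_def by blast
    qed
    ultimately show ?thesis using T_open by blast
  qed
  note nbhd = this
  have NU_L: "N <#> U \<subseteq> ?L"
    using O'(2) by (auto simp: set_mult_def)
  have "\<exists>T. openin (subtopology (topol G) ?L) T \<and> y \<in> T \<and> T \<subseteq> N <#> U" if y: "y \<in> N <#> U" for y
  proof -
    obtain T where T: "openin (topol G) T" "y \<in> T" "T \<inter> ?L \<subseteq> N <#> U"
      using nbhd[OF y] by blast
    have "openin (subtopology (topol G) ?L) (T \<inter> ?L)"
      using T(1) by (simp add: openin_subtopology_Int)
    moreover have "y \<in> T \<inter> ?L" using T(2) y NU_L by blast
    ultimately show ?thesis using T(3) by blast
  qed
  then show ?thesis
    by (subst openin_subopen) blast
qed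

end


section \<open>Composition series of contraction groups\<close>

context topological_group
begin

lemma inner_automorphisms_subset_top_Aut: "inner_automorphisms G \<subseteq> carrier (top_Aut G)"
proof
  fix f assume "f \<in> inner_automorphisms G"
  then obtain g where g: "g \<in> carrier G" and f: "f = (\<lambda>x\<in>carrier G. g \<otimes> x \<otimes> inv g)"
    by (auto simp: inner_automorphisms_def)
  let ?c = "\<lambda>g x. g \<otimes> x \<otimes> inv g"
  have cont: "continuous_map (topol G) (topol G) (?c h)" if "h \<in> carrier G" for h
    using that by (intro continuous_map_mult) (simp_all add: topspace_topol)
  have cancel: "?c h (?c (inv h) x) = x" "?c (inv h) (?c h x) = x"
    if "h \<in> carrier G" "x \<in> carrier G" for h x
  proof -
    have "h \<otimes> (inv h \<otimes> y) = y" "inv h \<otimes> (h \<otimes> y) = y" if "y \<in> carrier G" for y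
      using \<open>h \<in> carrier G\<close> that by (simp_all flip: m_assoc)
    then show "?c h (?c (inv h) x) = x" "?c (inv h) (?c h x) = x"
      using that by (simp_all add: m_assoc)
  qed
  have maps: "homeomorphic_maps (topol G) (topol G) (?c g) (?c (inv g))"
    unfolding homeomorphic_maps_def topspace_topol
    using cont[OF g] cont[of "inv g"] cancel[OF g] g by auto
  have homeo: "homeomorphic_map (topol G) (topol G) f"
    by (rule homeomorphic_map_eq[OF homeomorphic_maps_imp_map[OF maps]]) (simp add: f topspace_topol)
  have bij: "bij_betw f (carrier G) (carrier G)"
    using homeo homeomorphic_imp_injective_map homeomorphic_imp_surjective_map
    unfolding bij_betw_def by (metis topspace_topol)
  have "f \<in> hom G G"
  proof (rule homI)
    fix x y assume xy: "x \<in> carrier G" "y \<in> carrier G"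
    have "inv g \<otimes> (g \<otimes> z) = z" if "z \<in> carrier G" for z
      using g that by (simp flip: m_assoc)
    then show "f (x \<otimes> y) = f x \<otimes> f y"
      using g xy by (simp add: f m_assoc)
  qed (simp add: f g)
  moreover have "f \<in> Bij (carrier G)"
    using bij by (simp add: Bij_def f)
  ultimately show "f \<in> carrier (top_Aut G)"
    using homeo by (simp add: top_Aut_def auto_def)
qed

lemma inv_top_Aut_apply:
  assumes "\<alpha> \<in> carrier (top_Aut G)" "x \<in> carrier G"
  shows "(inv\<^bsub>top_Aut G\<^esub> \<alpha>) (\<alpha> x) = x"
proof -
  interpret A: group "top_Aut G" by (rule group_top_Aut)
  let ?b = "inv\<^bsub>top_Aut G\<^esub> \<alpha>"
  have "\<alpha> \<in> Bij (carrier G)" "?b \<in> Bij (carrier G)"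
    using assms(1) A.inv_closed[OF assms(1)] by (auto simp: top_Aut_def auto_def)
  then have "compose (carrier G) ?b \<alpha> = ?b \<otimes>\<^bsub>top_Aut G\<^esub> \<alpha>"
    by (simp add: top_Aut_def AutoGroup_def BijGroup_def)
  also have "\<dots> = (\<lambda>x\<in>carrier G. x)"
    using A.l_inv[OF assms(1)] by (simp add: top_Aut_def AutoGroup_def BijGroup_def)
  finally have "compose (carrier G) ?b \<alpha> x = (\<lambda>x\<in>carrier G. x) x" by simp
  then show ?thesis
    using assms(2) by (simp add: compose_def)
qed

end

lemma product_closed_op_group_of_contraction:
  assumes ops: "topological_op_group \<Omega> E" and contr: "contractive_group E \<alpha> W"
    and stable: "\<And>H. op_subgroup \<Omega> H E \<Longrightarrow> contractive_group.stable E \<alpha> H"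
  shows "product_closed_op_group \<Omega> E"
proof -
  interpret topological_op_group \<Omega> E by (rule ops)
  interpret C: contractive_group E \<alpha> W by (rule contr)
  show ?thesis
    using C.closedin_set_mult C.openin_set_mult stable
    by unfold_locales (auto simp: op_subgroup_def)
qed

theorem theorem3p3:
  fixes G :: "'a top_group" and \<alpha> :: "'a \<Rightarrow> 'a" and \<Omega> :: "('a \<Rightarrow> 'a) set"
  assumes "topological_group G"
    and "totally_disconnected_space (topol G)"
    and "locally_compact_space (topol G)"
    and "\<alpha> \<in> carrier (top_Aut G)"
    and "contractive G \<alpha>"
    and "\<Omega> = generate (top_Aut G) {\<alpha>} \<or>
         \<Omega> = generate (top_Aut G) (inner_automorphisms G \<union> {\<alpha>})"
  shows "(\<exists>S. composition_series \<Omega> (evaluation_op_group G) S) \<and>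
    (\<forall>S T. op_series \<Omega> (evaluation_op_group G) S \<and> op_series \<Omega> (evaluation_op_group G) T \<longrightarrow>
      (\<exists>S' T'. refinement \<Omega> (evaluation_op_group G) S S' \<and>
        refinement \<Omega> (evaluation_op_group G) T T' \<and>
        series_isomorphic \<Omega> (evaluation_op_group G) S' T')) \<and>
    (\<forall>S T. composition_series \<Omega> (evaluation_op_group G) S \<and>
      op_series \<Omega> (evaluation_op_group G) T \<longrightarrow>
      (\<exists>R. refinement \<Omega> (evaluation_op_group G) T R \<and>
        composition_series \<Omega> (evaluation_op_group G) R \<and>
        series_isomorphic \<Omega> (evaluation_op_group G) R S)) \<and>
    (\<forall>S T. composition_series \<Omega> (evaluation_op_group G) S \<and>
      composition_series \<Omega> (evaluation_op_group G) T \<longrightarrow>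
      series_isomorphic \<Omega> (evaluation_op_group G) S T)"
proof -
  interpret G: topological_group G by fact
  interpret A: group "top_Aut G" by (rule G.group_top_Aut)
  let ?E = "evaluation_op_group G" and ?\<beta> = "inv\<^bsub>top_Aut G\<^esub> \<alpha>"
  have gens: "{\<alpha>} \<subseteq> carrier (top_Aut G)" "inner_automorphisms G \<union> {\<alpha>} \<subseteq> carrier (top_Aut G)"
    using assms(4) G.inner_automorphisms_subset_top_Aut by auto
  have \<Omega>: "\<Omega> \<subseteq> carrier (top_Aut G)"
    using assms(6) A.generate_incl[OF gens(1)] A.generate_incl[OF gens(2)] by blast
  have \<alpha>\<beta>: "\<alpha> \<in> \<Omega>" "?\<beta> \<in> \<Omega>"
    using assms(6) by (auto intro: generate.incl generate.inv)
  have ops: "topological_op_group \<Omega> ?E"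
    by (rule G.topological_op_group_evaluation[OF \<Omega>])
  interpret E: topological_op_group \<Omega> ?E by (rule ops)
  have E_simps: "carrier ?E = carrier G" "topol ?E = topol G" "monoid.mult ?E = monoid.mult G" "one ?E = one G"
      "act ?E = (\<lambda>\<omega> x. \<omega> x)"
    by (simp_all add: evaluation_op_group_def)
  have hom: "\<alpha> \<in> hom ?E ?E"
    using E.act_hom[OF \<alpha>\<beta>(1)] by (simp add: E_simps)
  have homeo: "homeomorphic_map (topol ?E) (topol ?E) \<alpha>"
    using assms(4) by (simp add: E_simps top_Aut_def)
  have contr: "contractive ?E \<alpha>"
    using assms(5) by (simp add: contractive_def E_simps)
  obtain W where W: "contractive_group ?E \<alpha> W"
    using E.contractive_group_exists[OF _ _ hom homeo contr] assms(2,3) by (auto simp: E_simps)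
  interpret C: contractive_group ?E \<alpha> W by (rule W)
  have stable: "C.stable H" if H: "op_subgroup \<Omega> H ?E" for H
    unfolding C.stable_def
  proof (intro conjI ballI iffI)
    show "subgroup H ?E" using H by (simp add: op_subgroup_def)
    have inv: "\<omega> x \<in> H" if "\<omega> \<in> \<Omega>" "x \<in> H" for \<omega> x
      using H that by (simp add: op_subgroup_def E_simps)
    fix x assume x: "x \<in> carrier ?E"
    show "\<alpha> x \<in> H" if "x \<in> H" using inv[OF \<alpha>\<beta>(1) that] .
    show "x \<in> H" if "\<alpha> x \<in> H"
      using inv[OF \<alpha>\<beta>(2) that] G.inv_top_Aut_apply[OF assms(4)] x by (simp add: E_simps)
  qed
  interpret P: product_closed_op_group \<Omega> ?E
    by (rule product_closed_op_group_of_contraction[OF ops W stable])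
  have "card (set S) \<le> Suc (card (C.cosets_met (carrier ?E)))" if S: "op_series \<Omega> ?E S" for S
  proof (rule C.card_chain_of_stable_subgroups)
    show "C.stable H \<and> closedin (topol ?E) H" if "H \<in> set S" for H
      using S that stable by (auto simp: op_series_def op_subgroup_def)
    fix H K assume "H \<in> set S" "K \<in> set S"
    then obtain i j where "i < length S" "H = S ! i" "j < length S" "K = S ! j"
      by (auto simp: in_set_conv_nth)
    then show "H \<subseteq> K \<or> K \<subseteq> H"
      using P.op_series_mono[OF S, of i j] P.op_series_mono[OF S, of j i] nat_le_linear[of i j] by auto
  qed
  then have "\<exists>S. composition_series \<Omega> ?E S"
    by (rule P.composition_series_exists)
  then show ?thesis
    using P.Schreier_refinement_theorem P.Jordan_Hoelder_theorem P.composition_series_isomorphic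
    by blast
qed


end
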